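(* There is a non-trivial (i.e. not identically zero) $j$-derivation on $\mathbb{C}$.
   Context: $\mathbb{H}^+$ and $\mathbb{H}^-$ are the open upper and lower half planes in $\mathbb{C}$. On $\mathbb{H}^+$, $j$ is the classical modular $j$-function (normalised so that $j(i)=1728$); for $z\in\mathbb{H}^-$, $j(z)$ is defined as the complex conjugate of $j$ evaluated at the complex conjugate of $z$. Thus $j:\mathbb{H}^+\cup\mathbb{H}^-\to\mathbb{C}$ is holomorphic, and $j',j'',j'''$ denote its derivatives. A $j$-derivation on $\mathbb{C}$ is a derivation $\partial:\mathbb{C}\to\mathbb{C}$ (additive, satisfying $\partial(ab)=a\partial(b)+b\partial(a)$) such that for all $z\in\mathbb{H}^+\cup\mathbb{H}^-$: $\partial(j(z))=j'(z)\partial(z)$, $\partial(j'(z))=j''(z)\partial(z)$, $\partial(j''(z))=j'''(z)\partial(z)$. *)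

theory Defs
  imports "HOL-Complex_Analysis.Complex_Analysis"
begin

text \<open>Sums over the nonzero points of the lattice spanned by \<open>1\<close> and \<open>z\<close>. For \<open>k \<ge> 3\<close> and
  non-real \<open>z\<close> the sum converges absolutely, so \<open>infsum\<close> has its intended value.\<close>

definition lattice_sum :: "nat \<Rightarrow> complex \<Rightarrow> complex" where
  "lattice_sum k z =
     (\<Sum>\<^sub>\<infinity>(m, n)\<in>(UNIV :: (int \<times> int) set) - {(0, 0)}. 1 / (of_int m + of_int n * z) ^ k)"

definition g2 :: "complex \<Rightarrow> complex" where
  "g2 z = 60 * lattice_sum 4 z"

definition g3 :: "complex \<Rightarrow> complex" where
  "g3 z = 140 * lattice_sum 6 z"

text \<open>The classical \<open>j\<close>-function on the upper half plane. The factor 1728 is the normalisation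
  \<open>j(\<i>) = 1728\<close>, since \<open>g3 \<i> = 0\<close>.\<close>

definition klein_j :: "complex \<Rightarrow> complex" where
  "klein_j z = 1728 * g2 z ^ 3 / (g2 z ^ 3 - 27 * g3 z ^ 2)"

text \<open>The value 0 on the real line is junk; the derivatives of \<open>j_fun\<close> are used only on the two
  open half planes.\<close>

definition j_fun :: "complex \<Rightarrow> complex" where
  "j_fun z = (if Im z > 0 then klein_j z
              else if Im z < 0 then cnj (klein_j (cnj z))
              else 0)"

definition derivation :: "(complex \<Rightarrow> complex) \<Rightarrow> bool" where
  "derivation D \<longleftrightarrow>
     (\<forall>a b. D (a + b) = D a + D b) \<and>
     (\<forall>a b. D (a * b) = a * D b + b * D a)"

definition j_derivation :: "(complex \<Rightarrow> complex) \<Rightarrow> bool" where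
  "j_derivation D \<longleftrightarrow> derivation D \<and>
     (\<forall>z. Im z > 0 \<or> Im z < 0 \<longrightarrow>
        D (j_fun z) = deriv j_fun z * D z \<and>
        D (deriv j_fun z) = (deriv ^^ 2) j_fun z * D z \<and>
        D ((deriv ^^ 2) j_fun z) = (deriv ^^ 3) j_fun z * D z)"

end

theory Submission
  imports Defs "HOL-Library.Function_Algebras"
begin

text \<open>Let \<open>V\<close> be the complex vector space with one basis vector for every complex number, modulo
  the relations that express a derivation compatible with \<open>j\<close>. A nontrivial \<open>j\<close>-derivation is a
  linear functional on \<open>V\<close> that is nonzero on the vector of some \<open>t\<close>. If there were none, then for
  every \<open>t\<close> the vector of \<open>t\<close> would be a finite combination of relations: \<open>t\<close> would be a coordinate
  \<open>z q\<close> of a point \<open>z \<in> \<complex>\<^sup>n\<close> such that the \<open>q\<close>-th unit covector is in the span of the gradients at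
  \<open>z\<close> of functions which vanish at \<open>z\<close> and are built from countably many symbols. Choose among these
  functions a maximal family \<open>F\<close> with independent gradients at \<open>z\<close>. By maximality, every further such
  function vanishes to infinite order at \<open>z\<close> along each holomorphic curve in \<open>{F = 0}\<close> through \<open>z\<close>,
  so the coordinate \<open>q\<close> is constant on \<open>{F = 0}\<close> near \<open>z\<close>. Each of the countably many \<open>F\<close> therefore
  accounts for only countably many \<open>t\<close>, contradicting the uncountability of \<open>\<complex>\<close>.\<close>

subsection \<open>Terms and their formal partial derivatives\<close>

text \<open>\<open>\<kappa>\<close> enumerates constants which the derivation to be constructed has to annihilate.\<close>

locale derivative_family =
  fixes \<phi> :: "nat \<Rightarrow> complex \<Rightarrow> complex" and \<Omega> :: "complex set" and \<kappa> :: "nat \<Rightarrow> complex"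
  assumes open_dom: "open \<Omega>"
    and has_deriv: "z \<in> \<Omega> \<Longrightarrow> (\<phi> r has_field_derivative \<phi> (Suc r) z) (at z)"

text \<open>Constants and function symbols carry indices in \<open>nat\<close>, so there are only
  countably many terms; the final counting argument rests on this. \<open>App r\<close> stands for
  \<open>\<phi> r\<close>, which closes the language under formal differentiation, and
  \<open>Inv\<close> serves to normalise pivots.\<close>

datatype tm = Var nat | Cst nat | Zero | One | Add tm tm | Neg tm | Mul tm tm | Inv tm | App nat tm

instance tm :: countable
  by countable_datatype

primrec pd :: "nat \<Rightarrow> tm \<Rightarrow> tm" where
  "pd k (Var i) = (if i = k then One else Zero)"
| "pd k (Cst i) = Zero"
| "pd k Zero = Zero"
| "pd k One = Zero"
| "pd k (Add a b) = Add (pd k a) (pd k b)"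
| "pd k (Neg a) = Neg (pd k a)"
| "pd k (Mul a b) = Add (Mul (pd k a) b) (Mul a (pd k b))"
| "pd k (Inv a) = Neg (Mul (pd k a) (Mul (Inv a) (Inv a)))"
| "pd k (App r a) = Mul (App (Suc r) a) (pd k a)"

primrec Sum :: "(nat \<Rightarrow> tm) \<Rightarrow> nat \<Rightarrow> tm" where
  "Sum f 0 = Zero"
| "Sum f (Suc m) = Add (Sum f m) (f m)"

lemma pd_Sum: "pd k (Sum f m) = Sum (\<lambda>i. pd k (f i)) m"
  by (induction m) auto

text \<open>Points of \<open>\<complex>\<^sup>n\<close> are encoded as functions on \<open>nat\<close> vanishing from \<open>n\<close> on, since \<open>n\<close> has to vary.\<close>

definition supp :: "nat \<Rightarrow> (nat \<Rightarrow> complex) set" where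
  "supp n = {x. \<forall>k\<ge>n. x k = 0}"

section \<open>Metric and neighbourhoods on n-dimensional complex space\<close>

definition dist1 :: "nat \<Rightarrow> (nat \<Rightarrow> complex) \<Rightarrow> (nat \<Rightarrow> complex) \<Rightarrow> real" where
  "dist1 n x y = (\<Sum>k<n. norm (x k - y k))"

text \<open>On \<open>supp n\<close> these are the usual neighbourhoods in n-dimensional space. The
  form as a filter makes the general limit rules applicable although the dimension is only a
  parameter.\<close>

definition near :: "nat \<Rightarrow> (nat \<Rightarrow> complex) \<Rightarrow> (nat \<Rightarrow> complex) filter" where
  "near n x = inf (filtercomap (dist1 n x) (nhds 0)) (principal (supp n))"

lemma dist1_nonneg: "dist1 n x y \<ge> 0"
  by (simp add: dist1_def sum_nonneg)

lemma dist1_self [simp]: "dist1 n x x = 0"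
  by (simp add: dist1_def)

lemma dist1_triangle: "dist1 n x w \<le> dist1 n x y + dist1 n y w"
  unfolding dist1_def sum.distrib [symmetric]
  by (rule sum_mono) (metis dist_norm dist_triangle)

lemma norm_le_dist1: "k < n \<Longrightarrow> norm (x k - y k) \<le> dist1 n x y"
  unfolding dist1_def by (rule member_le_sum) auto

lemma eventually_near:
  "eventually P (near n x) \<longleftrightarrow> (\<exists>\<delta>>0. \<forall>y\<in>supp n. dist1 n x y < \<delta> \<longrightarrow> P y)"
proof
  assume "eventually P (near n x)"
  then obtain Q where Q: "eventually Q (nhds 0)" "\<And>y. Q (dist1 n x y) \<Longrightarrow> y \<in> supp n \<Longrightarrow> P y"
    by (auto simp: near_def eventually_inf_principal eventually_filtercomap)
  from Q(1) obtain \<delta> where "\<delta> > 0" "\<And>d. dist d 0 < \<delta> \<Longrightarrow> Q d"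
    by (auto simp: eventually_nhds_metric)
  with Q(2) show "\<exists>\<delta>>0. \<forall>y\<in>supp n. dist1 n x y < \<delta> \<longrightarrow> P y"
    by (intro exI [of _ \<delta>]) (auto simp: dist1_nonneg)
next
  assume "\<exists>\<delta>>0. \<forall>y\<in>supp n. dist1 n x y < \<delta> \<longrightarrow> P y"
  then obtain \<delta> where "\<delta> > 0" "\<forall>y\<in>supp n. dist1 n x y < \<delta> \<longrightarrow> P y"
    by blast
  then show "eventually P (near n x)"
    unfolding near_def eventually_inf_principal eventually_filtercomap
    by (intro exI [of _ "\<lambda>d. d < \<delta>"]) (auto intro: order_tendstoD [OF filterlim_ident])
qed

lemma tendsto_coord:
  assumes "x \<in> supp n"
  shows "((\<lambda>y. y k) \<longlongrightarrow> x k) (near n x)"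
proof (cases "k < n")
  case True
  show ?thesis
    unfolding tendsto_iff eventually_near
  proof (intro allI impI)
    fix e :: real assume "e > 0"
    then show "\<exists>\<delta>>0. \<forall>y\<in>supp n. dist1 n x y < \<delta> \<longrightarrow> dist (y k) (x k) < e"
      using norm_le_dist1 [OF True, of x]
      by (intro exI [of _ e]) (auto simp: dist_norm norm_minus_commute intro: le_less_trans)
  qed
next
  case False
  then have "eventually (\<lambda>y. y k = x k) (near n x)"
    using assms by (auto simp: eventually_near supp_def intro!: exI [of _ 1])
  then show ?thesis
    by (rule tendsto_eventually)
qed

section \<open>Evaluation of terms, definedness and the chain rule\<close>

context derivative_family
begin

primrec eval :: "tm \<Rightarrow> (nat \<Rightarrow> complex) \<Rightarrow> complex" where
  "eval (Var i) x = x i"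
| "eval (Cst i) x = \<kappa> i"
| "eval Zero x = 0"
| "eval One x = 1"
| "eval (Add a b) x = eval a x + eval b x"
| "eval (Neg a) x = - eval a x"
| "eval (Mul a b) x = eval a x * eval b x"
| "eval (Inv a) x = inverse (eval a x)"
| "eval (App r a) x = \<phi> r (eval a x)"

text \<open>Every divisor is nonzero and every argument of \<open>\<phi>\<close> lies in \<Omega>.
  Without this, \<open>eval\<close> may return junk such as \<open>inverse 0 = 0\<close>, and
  \<open>pd\<close> need not compute its derivative.\<close>

primrec ok :: "tm \<Rightarrow> (nat \<Rightarrow> complex) \<Rightarrow> bool" where
  "ok (Var i) x = True"
| "ok (Cst i) x = True"
| "ok Zero x = True"
| "ok One x = True"
| "ok (Add a b) x = (ok a x \<and> ok b x)"
| "ok (Neg a) x = ok a x"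
| "ok (Mul a b) x = (ok a x \<and> ok b x)"
| "ok (Inv a) x = (ok a x \<and> eval a x \<noteq> 0)"
| "ok (App r a) x = (ok a x \<and> eval a x \<in> \<Omega>)"

lemma ok_pd: "ok t x \<Longrightarrow> ok (pd k t) x"
  by (induction t) auto

lemma eval_Sum: "eval (Sum f m) x = (\<Sum>i<m. eval (f i) x)"
  by (induction m) auto

lemma ok_Sum: "ok (Sum f m) x \<longleftrightarrow> (\<forall>i<m. ok (f i) x)"
  by (induction m) (auto simp: less_Suc_eq)

text \<open>The chain rule by induction on terms. It is the only link between \<open>pd\<close> and
  analysis: calculus in several variables is done along curves in one complex variable. Variables
  from \<open>n\<close> on are constantly zero by \<open>supp\<close>, so the sum over
  \<open>k < n\<close> is the whole derivative.\<close>

lemma has_derivative_eval: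
  assumes "\<And>k. k < n \<Longrightarrow> ((\<lambda>s. \<gamma> s k) has_field_derivative v k) (at s)"
    and supp: "\<And>s. \<gamma> s \<in> supp n"
    and "ok t (\<gamma> s)"
  shows "((\<lambda>s. eval t (\<gamma> s)) has_field_derivative (\<Sum>k<n. eval (pd k t) (\<gamma> s) * v k)) (at s)"
  using assms(3)
proof (induction t)
  case (Var i)
  show ?case
  proof (cases "i < n")
    case True
    have "(\<Sum>k<n. eval (pd k (Var i)) (\<gamma> s) * v k) = (\<Sum>k<n. if k = i then v k else 0)"
      by (rule sum.cong) auto
    then show ?thesis
      using True assms(1) by simp
  next
    case False
    then have "(\<lambda>s. eval (Var i) (\<gamma> s)) = (\<lambda>s. 0)"
      using supp by (auto simp: supp_def)
    moreover have "(\<Sum>k<n. eval (pd k (Var i)) (\<gamma> s) * v k) = 0"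
      using False by (intro sum.neutral) auto
    ultimately show ?thesis
      by simp
  qed
next
  case (Add a b)
  then show ?case
    by (auto intro!: derivative_eq_intros simp: sum.distrib ring_distribs)
next
  case (Neg a)
  then show ?case
    by (auto intro!: derivative_eq_intros simp: sum_negf)
next
  case (Mul a b)
  then show ?case
    by (auto intro!: derivative_eq_intros simp: sum.distrib ring_distribs sum_distrib_left sum_distrib_right mult_ac)
next
  case (Inv a)
  then show ?case
    by (auto intro!: derivative_eq_intros simp: sum_negf sum_distrib_left sum_distrib_right mult_ac)
next
  case (App r a)
  then have "((\<lambda>s. \<phi> r (eval a (\<gamma> s))) has_field_derivative
      \<phi> (Suc r) (eval a (\<gamma> s)) * (\<Sum>k<n. eval (pd k a) (\<gamma> s) * v k)) (at s)"
    by (intro DERIV_chain2 [OF has_deriv]) auto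
  then show ?case
    by (simp add: sum_distrib_left mult_ac)
qed auto

text \<open>Both claims are proved in one induction, since for \<open>Inv\<close> and
  \<open>App\<close> definedness near \<open>x\<close> follows from continuity of the
  argument.\<close>

lemma
  assumes "x \<in> supp n" "ok t x"
  shows tendsto_eval: "(eval t \<longlongrightarrow> eval t x) (near n x)"
    and eventually_ok: "eventually (ok t) (near n x)"
proof -
  have "(eval t \<longlongrightarrow> eval t x) (near n x) \<and> eventually (ok t) (near n x)"
    using assms(2)
  proof (induction t)
    case (Var i)
    then show ?case
      using tendsto_coord [OF assms(1)] by simp
  next
    case (Add a b)
    then show ?case by (auto intro!: tendsto_intros eventually_conj)
  next
    case (Neg a)
    then show ?case by (auto intro!: tendsto_intros)
  next
    case (Mul a b)
    then show ?case by (auto intro!: tendsto_intros eventually_conj)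
  next
    case (Inv a)
    then show ?case
      by (auto intro!: tendsto_intros eventually_conj tendsto_imp_eventually_ne)
  next
    case (App r a)
    then have "isCont (\<phi> r) (eval a x)"
      by (intro DERIV_isCont [OF has_deriv]) auto
    with App show ?case
      by (auto intro!: eventually_conj isCont_tendsto_compose [of _ "\<phi> r"]
          topological_tendstoD [OF _ open_dom])
  qed (auto intro!: tendsto_eventually always_eventually)
  then show "(eval t \<longlongrightarrow> eval t x) (near n x)" "eventually (ok t) (near n x)"
    by auto
qed

text \<open>Strict differentiability at \<open>z\<close>, by the mean value inequality on the
  segment from \<open>y'\<close> to \<open>y\<close>, where the gradient stays within \<epsilon> of
  its value at \<open>z\<close>. The form with two moving points is what later makes the correction
  map a contraction.\<close>

lemma eval_linear_approx:
  assumes z: "z \<in> supp n" "ok t z" and "\<epsilon> > 0"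
  obtains \<delta> where "\<delta> > 0"
    and "\<And>y. y \<in> supp n \<Longrightarrow> dist1 n z y < \<delta> \<Longrightarrow> ok t y"
    and "\<And>y y'. y \<in> supp n \<Longrightarrow> y' \<in> supp n \<Longrightarrow> dist1 n z y < \<delta> \<Longrightarrow> dist1 n z y' < \<delta> \<Longrightarrow>
      norm (eval t y - eval t y' - (\<Sum>k<n. eval (pd k t) z * (y k - y' k))) \<le> \<epsilon> * dist1 n y y'"
proof -
  have "eventually (\<lambda>y. ok t y \<and> (\<forall>k\<in>{..<n}. dist (eval (pd k t) y) (eval (pd k t) z) < \<epsilon>)) (near n z)"
    using z \<open>\<epsilon> > 0\<close>
    by (intro eventually_conj eventually_ball_finite) (auto intro: eventually_ok tendstoD [OF tendsto_eval] ok_pd)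
  then obtain \<delta> where \<delta>: "\<delta> > 0"
    and ok: "\<And>y. y \<in> supp n \<Longrightarrow> dist1 n z y < \<delta> \<Longrightarrow> ok t y"
    and close: "\<And>y k. y \<in> supp n \<Longrightarrow> dist1 n z y < \<delta> \<Longrightarrow> k < n \<Longrightarrow>
        norm (eval (pd k t) y - eval (pd k t) z) < \<epsilon>"
    unfolding eventually_near by (auto simp: dist_norm)
  show ?thesis
  proof (rule that [OF \<delta> ok])
    fix y y' assume y: "y \<in> supp n" "y' \<in> supp n" "dist1 n z y < \<delta>" "dist1 n z y' < \<delta>"
    define \<gamma> where "\<gamma> s k = y' k + s * (y k - y' k)" for s k
    have \<gamma>_supp: "\<gamma> s \<in> supp n" for s
      using y by (auto simp: \<gamma>_def supp_def)
    have \<gamma>_near: "dist1 n z (\<gamma> s) < \<delta>" if "s \<in> closed_segment 0 1" for s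
    proof -
      from that obtain u where u: "s = of_real u" "0 \<le> u" "u \<le> 1"
        by (auto simp: closed_segment_def of_real_def)
      have "dist1 n z (\<gamma> s) \<le> (\<Sum>k<n. (1 - u) * norm (z k - y' k) + u * norm (z k - y k))"
        unfolding dist1_def
      proof (rule sum_mono)
        fix k
        have "z k - \<gamma> s k = of_real (1 - u) * (z k - y' k) + of_real u * (z k - y k)"
          by (simp add: \<gamma>_def u algebra_simps)
        then show "norm (z k - \<gamma> s k) \<le> (1 - u) * norm (z k - y' k) + u * norm (z k - y k)"
          using u norm_triangle_ineq [of "of_real (1 - u) * (z k - y' k)" "of_real u * (z k - y k)"]
          by (simp add: norm_mult del: of_real_diff)
      qed
      also have "\<dots> = (1 - u) * dist1 n z y' + u * dist1 n z y"
        by (simp add: dist1_def sum.distrib sum_distrib_left)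
      also have "\<dots> < \<delta>"
        using convex_bound_lt [of "dist1 n z y'" \<delta> "dist1 n z y" "1 - u" u] y u by simp
      finally show ?thesis .
    qed
    \<comment> \<open>With the linear part at \<open>z\<close> removed, the derivative along the
      segment is small.\<close>
    define f where "f s = eval t (\<gamma> s) - (\<Sum>k<n. eval (pd k t) z * \<gamma> s k)" for s
    have "norm (f 1 - f 0) \<le> (\<epsilon> * dist1 n y y') * norm (1 - 0 :: complex)"
    proof (rule field_differentiable_bound [of "closed_segment 0 1" f])
      fix s :: complex assume s: "s \<in> closed_segment 0 1"
      have D: "((\<lambda>s. \<gamma> s k) has_field_derivative (y k - y' k)) (at s)" for k
        unfolding \<gamma>_def by (auto intro!: derivative_eq_intros)
      have "(f has_field_derivative ((\<Sum>k<n. eval (pd k t) (\<gamma> s) * (y k - y' k)) -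
            (\<Sum>k<n. eval (pd k t) z * (y k - y' k)))) (at s)"
        unfolding f_def
        by (intro DERIV_diff has_derivative_eval DERIV_sum DERIV_cmult D \<gamma>_supp ok \<gamma>_near s)
      then show "(f has_field_derivative
            (\<Sum>k<n. (eval (pd k t) (\<gamma> s) - eval (pd k t) z) * (y k - y' k))) (at s within closed_segment 0 1)"
        by (simp add: left_diff_distrib sum_subtractf DERIV_subset [where s = UNIV])
      have "norm (\<Sum>k<n. (eval (pd k t) (\<gamma> s) - eval (pd k t) z) * (y k - y' k))
          \<le> (\<Sum>k<n. \<epsilon> * norm (y k - y' k))"
        by (intro sum_norm_le)
          (auto simp: norm_mult intro!: mult_right_mono less_imp_le [OF close] \<gamma>_supp \<gamma>_near s)
      then show "norm (\<Sum>k<n. (eval (pd k t) (\<gamma> s) - eval (pd k t) z) * (y k - y' k)) \<le> \<epsilon> * dist1 n y y'"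
        by (simp add: dist1_def sum_distrib_left)
    qed auto
    moreover have "\<gamma> 1 = y" "\<gamma> 0 = y'"
      by (auto simp: \<gamma>_def)
    ultimately show "norm (eval t y - eval t y' - (\<Sum>k<n. eval (pd k t) z * (y k - y' k))) \<le> \<epsilon> * dist1 n y y'"
      by (simp add: f_def right_diff_distrib sum_subtractf algebra_simps)
  qed auto
qed


subsection \<open>Holomorphic curves in zero sets\<close>

text \<open>Independence of gradients in row-reduced form: the Jacobian of the \<open>F i\<close> at
  \<open>z\<close> has the identity matrix in the columns \<open>p j\<close>. Hence no matrix has to
  be inverted when the zero equations are solved for the pivot coordinates.\<close>

definition pivotal :: "nat \<Rightarrow> (nat \<Rightarrow> complex) \<Rightarrow> nat \<Rightarrow> (nat \<Rightarrow> tm) \<Rightarrow> (nat \<Rightarrow> nat) \<Rightarrow> bool" where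
  "pivotal n z m F p \<longleftrightarrow> (\<forall>i<m. ok (F i) z \<and> eval (F i) z = 0 \<and> p i < n \<and>
     (\<forall>j<m. eval (pd (p j) (F i)) z = (if i = j then 1 else 0)))"

text \<open>Correct the segment from \<open>z\<close> to \<open>w\<close> in the pivot coordinates: near \<open>z\<close> the map
  \<open>c \<mapsto> c - F (y s c)\<close> is a contraction, its iterates are holomorphic in \<open>s\<close>, and for
  \<open>s = 0\<close> and \<open>s = 1\<close> no correction is needed.\<close>

lemma holomorphic_curve_in_zero_set:
  assumes z: "z \<in> supp n" and piv: "pivotal n z m F p"
  shows "\<exists>\<delta>>0. \<forall>w\<in>supp n. dist1 n z w < \<delta> \<longrightarrow> (\<forall>i<m. eval (F i) w = 0) \<longrightarrow>
    (\<exists>\<gamma>. (\<forall>k. (\<lambda>s. \<gamma> s k) holomorphic_on ball 0 2) \<and> \<gamma> 0 = z \<and> \<gamma> 1 = w \<and>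
      (\<forall>s. \<gamma> s \<in> supp n) \<and> (\<forall>s\<in>ball 0 2. \<forall>i<m. eval (F i) (\<gamma> s) = 0))"
proof -
  have F: "\<And>i. i < m \<Longrightarrow> ok (F i) z" "\<And>i. i < m \<Longrightarrow> eval (F i) z = 0"
    and p: "\<And>i. i < m \<Longrightarrow> p i < n"
    and pivot: "\<And>i j. i < m \<Longrightarrow> j < m \<Longrightarrow> eval (pd (p j) (F i)) z = (if i = j then 1 else 0)"
    using piv by (auto simp: pivotal_def)
  \<comment> \<open>Each of the \<open>m\<close> components of the correction map is Lipschitz with
    constant \<epsilon>, so their sum has constant at most 1/2.\<close>
  define \<epsilon> :: real where "\<epsilon> = 1 / (2 * real (Suc m))"
  have "\<epsilon> > 0"
    by (simp add: \<epsilon>_def)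
  have m\<epsilon>: "real m * \<epsilon> \<le> 1 / 2"
    by (simp add: \<epsilon>_def field_simps)
  define Q where "Q i \<delta> \<longleftrightarrow> \<delta> > 0 \<and> (\<forall>y\<in>supp n. dist1 n z y < \<delta> \<longrightarrow> ok (F i) y) \<and>
     (\<forall>y\<in>supp n. \<forall>y'\<in>supp n. dist1 n z y < \<delta> \<longrightarrow> dist1 n z y' < \<delta> \<longrightarrow>
      norm (eval (F i) y - eval (F i) y' - (\<Sum>k<n. eval (pd k (F i)) z * (y k - y' k))) \<le> \<epsilon> * dist1 n y y')"
    for i \<delta>
  have "\<exists>\<delta>. Q i \<delta>" if "i < m" for i
    unfolding Q_def by (rule eval_linear_approx [OF z F(1) [OF that] \<open>\<epsilon> > 0\<close>]) blast
  then obtain d where Qd: "\<And>i. i < m \<Longrightarrow> Q i (d i)"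
    by metis
  note d = Qd [unfolded Q_def, THEN conjunct1]
    and ok_d = Qd [unfolded Q_def, THEN conjunct2, THEN conjunct1, rule_format]
    and lin_d = Qd [unfolded Q_def, THEN conjunct2, THEN conjunct2, rule_format]
  define \<rho> where "\<rho> = Min (insert 1 (d ` {..<m}))"
  have \<rho>: "\<rho> > 0"
    using d by (simp add: \<rho>_def)
  have \<rho>_le: "\<rho> \<le> d i" if "i < m" for i
    using that by (simp add: \<rho>_def)
  \<comment> \<open>Summed over \<open>i < m\<close>, this bound keeps the first iterate within
    \<open>\<rho> / 4\<close>; a contraction with factor 1/2 then keeps all iterates within
    \<open>\<rho> / 2\<close>.\<close>
  have "eventually (\<lambda>y. \<forall>i\<in>{..<m}. norm (eval (F i) y) < \<rho> * \<epsilon> / 2) (near n z)"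
  proof (intro eventually_ball_finite ballI)
    fix i assume "i \<in> {..<m}"
    then show "eventually (\<lambda>y. norm (eval (F i) y) < \<rho> * \<epsilon> / 2) (near n z)"
      using tendstoD [OF tendsto_eval [OF z F(1)], of i "\<rho> * \<epsilon> / 2"] F(2) \<rho> \<open>\<epsilon> > 0\<close>
      by simp
  qed auto
  then obtain \<eta> where \<eta>: "\<eta> > 0"
    and small: "\<And>y i. y \<in> supp n \<Longrightarrow> dist1 n z y < \<eta> \<Longrightarrow> i < m \<Longrightarrow> norm (eval (F i) y) < \<rho> * \<epsilon> / 2"
    unfolding eventually_near by blast
  \<comment> \<open>For \<open>norm s < 2\<close> the uncorrected point is less than 2 \<delta> away
    from \<open>z\<close>. This is at most \<eta>, which makes the first iterate small, and at most
    \<open>\<rho> / 2\<close>, which leaves \<open>\<rho> / 2\<close> for the correction. Radius 2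
    puts both parameters 0 and 1 inside the disc.\<close>
  define \<delta> where "\<delta> = min (\<eta> / 2) (\<rho> / 4)"
  have "\<delta> > 0"
    using \<rho> \<eta> by (simp add: \<delta>_def)
  show ?thesis
  proof (intro exI [of _ \<delta>] conjI ballI impI \<open>\<delta> > 0\<close>)
    fix w assume w: "w \<in> supp n" "dist1 n z w < \<delta>" and Fw: "\<forall>i<m. eval (F i) w = 0"
    define y where "y s c k = z k + s * (w k - z k) + (\<Sum>j<m. if p j = k then c j else 0)"
      for s :: complex and c k
    define L where "L c = (\<Sum>i<m. norm (c i))" for c :: "nat \<Rightarrow> complex"
    define \<Phi> where "\<Phi> s c i = c i - eval (F i) (y s c)" for s c i
    have L_nonneg: "L c \<ge> 0" for c
      by (simp add: L_def sum_nonneg)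
    have le_L: "norm (c i) \<le> L c" if "i < m" for c i
      unfolding L_def using that by (intro member_le_sum) auto
    have y_supp: "y s c \<in> supp n" for s c
      using z w(1) p by (fastforce simp: y_def supp_def intro!: sum.neutral)
    have sum_if: "(\<Sum>k<n. norm (\<Sum>j<m. if p j = k then c j else 0)) \<le> L c" for c :: "nat \<Rightarrow> complex"
    proof -
      have "(\<Sum>k<n. norm (\<Sum>j<m. if p j = k then c j else 0)) \<le> (\<Sum>k<n. \<Sum>j<m. if p j = k then norm (c j) else 0)"
        by (intro sum_mono order.trans [OF norm_sum]) (auto intro!: sum_mono)
      also have "\<dots> = (\<Sum>j<m. \<Sum>k<n. if p j = k then norm (c j) else 0)"
        by (rule sum.swap)
      also have "\<dots> = L c"
        unfolding L_def by (intro sum.cong) (auto simp: p)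
      finally show ?thesis .
    qed
    have y_diff: "y s c k - y s c' k = (\<Sum>j<m. if p j = k then c j - c' j else 0)" for s c c' k
      unfolding y_def by (auto simp: sum_subtractf [symmetric] intro!: sum.cong)
    have y_dist: "dist1 n (y s c) (y s c') \<le> L (\<lambda>i. c i - c' i)" for s c c'
      unfolding dist1_def y_diff by (rule sum_if)
    have y_near: "dist1 n z (y s c) < \<rho>" if "norm s < 2" "L c \<le> \<rho> / 2" for s c
    proof -
      have "dist1 n z (y s c) \<le> dist1 n z (y s (\<lambda>_. 0)) + dist1 n (y s (\<lambda>_. 0)) (y s c)"
        by (rule dist1_triangle)
      also have "dist1 n z (y s (\<lambda>_. 0)) = norm s * dist1 n z w"
        by (auto simp: dist1_def y_def sum_distrib_left norm_mult norm_minus_commute intro!: sum.cong)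
      also have "\<dots> \<le> 2 * dist1 n z w"
        using that(1) by (intro mult_right_mono) (auto simp: dist1_nonneg)
      also have "\<dots> < \<rho> / 2"
        using w(2) by (simp add: \<delta>_def)
      also have "dist1 n (y s (\<lambda>_. 0)) (y s c) \<le> \<rho> / 2"
        using y_dist [of s "\<lambda>_. 0" c] that(2) by (simp add: L_def)
      finally show ?thesis by simp
    qed
    have contr: "L (\<lambda>i. \<Phi> s c i - \<Phi> s c' i) \<le> L (\<lambda>i. c i - c' i) / 2"
      if s: "norm s < 2" and c: "L c \<le> \<rho> / 2" "L c' \<le> \<rho> / 2" for s c c'
    proof -
      have "norm (\<Phi> s c i - \<Phi> s c' i) \<le> \<epsilon> * L (\<lambda>i. c i - c' i)" if i: "i < m" for i
      proof -
        \<comment> \<open>By the identity block, the linear part of \<open>F i\<close> in the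
          correction directions is exactly \<open>c i - c' i\<close>; it cancels in
          \<open>\<Phi>\<close>, and only the small remainder is left.\<close>
        have "(\<Sum>k<n. eval (pd k (F i)) z * (y s c k - y s c' k)) =
            (\<Sum>k<n. \<Sum>j<m. if p j = k then eval (pd (p j) (F i)) z * (c j - c' j) else 0)"
          unfolding y_diff by (auto simp: sum_distrib_left intro!: sum.cong)
        also have "\<dots> = (\<Sum>j<m. \<Sum>k<n. if p j = k then eval (pd (p j) (F i)) z * (c j - c' j) else 0)"
          by (rule sum.swap)
        also have "\<dots> = (\<Sum>j<m. eval (pd (p j) (F i)) z * (c j - c' j))"
          by (intro sum.cong) (auto simp: p)
        also have "\<dots> = (\<Sum>j<m. if j = i then c j - c' j else 0)"
          by (intro sum.cong) (auto simp: pivot i)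
        also have "\<dots> = c i - c' i"
          using i by simp
        finally have "\<Phi> s c i - \<Phi> s c' i = - (eval (F i) (y s c) - eval (F i) (y s c') -
            (\<Sum>k<n. eval (pd k (F i)) z * (y s c k - y s c' k)))"
          by (simp add: \<Phi>_def)
        then have "norm (\<Phi> s c i - \<Phi> s c' i) = norm (eval (F i) (y s c) - eval (F i) (y s c') -
            (\<Sum>k<n. eval (pd k (F i)) z * (y s c k - y s c' k)))"
          by (metis norm_minus_cancel)
        also have "\<dots> \<le> \<epsilon> * dist1 n (y s c) (y s c')"
          using y_near [OF s c(1)] y_near [OF s c(2)] \<rho>_le [OF i] i
          by (intro lin_d y_supp) auto
        also have "\<dots> \<le> \<epsilon> * L (\<lambda>i. c i - c' i)"
          using \<open>\<epsilon> > 0\<close> y_dist by (intro mult_left_mono) auto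
        finally show ?thesis .
      qed
      then have "L (\<lambda>i. \<Phi> s c i - \<Phi> s c' i) \<le> (\<Sum>i<m. \<epsilon> * L (\<lambda>i. c i - c' i))"
        by (subst L_def) (intro sum_mono, auto)
      also have "\<dots> = (real m * \<epsilon>) * L (\<lambda>i. c i - c' i)"
        by simp
      also have "\<dots> \<le> (1 / 2) * L (\<lambda>i. c i - c' i)"
        by (intro mult_right_mono m\<epsilon> L_nonneg)
      finally show ?thesis by simp
    qed
    have \<Phi>0: "L (\<Phi> s (\<lambda>_. 0)) \<le> \<rho> / 4" if "norm s < 2" for s
    proof -
      have "dist1 n z (y s (\<lambda>_. 0)) = norm s * dist1 n z w"
        by (auto simp: dist1_def y_def sum_distrib_left norm_mult norm_minus_commute intro!: sum.cong)
      also have "\<dots> \<le> 2 * dist1 n z w"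
        using that by (intro mult_right_mono) (auto simp: dist1_nonneg)
      also have "\<dots> < \<eta>"
        using w(2) by (simp add: \<delta>_def)
      finally have "L (\<Phi> s (\<lambda>_. 0)) \<le> (\<Sum>i<m. \<rho> * \<epsilon> / 2)"
        unfolding L_def \<Phi>_def using small [OF y_supp]
        by (intro sum_mono less_imp_le) auto
      also have "\<dots> = (real m * \<epsilon>) * (\<rho> / 2)"
        by simp
      also have "\<dots> \<le> (1 / 2) * (\<rho> / 2)"
        using \<rho> by (intro mult_right_mono m\<epsilon>) auto
      finally show ?thesis by simp
    qed
    define c where "c N s = (\<Phi> s ^^ N) (\<lambda>_. 0)" for N s
    have c_0: "c 0 s = (\<lambda>_. 0)" and c_Suc: "c (Suc N) s = \<Phi> s (c N s)" for N s
      by (simp_all add: c_def)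
    have L_triangle: "L a \<le> L b + L (\<lambda>i. a i - b i)" for a b
      unfolding L_def sum.distrib [symmetric] by (intro sum_mono) (metis norm_triangle_sub)
    have c_bound: "L (c N s) \<le> \<rho> / 2" if s: "norm s < 2" for N s
    proof (induction N)
      case 0
      then show ?case using \<rho> by (simp add: c_0 L_def)
    next
      case (Suc N)
      have "L (c (Suc N) s) \<le> L (\<Phi> s (\<lambda>_. 0)) + L (\<lambda>i. \<Phi> s (c N s) i - \<Phi> s (\<lambda>_. 0) i)"
        unfolding c_Suc by (rule L_triangle)
      also have "\<dots> \<le> \<rho> / 4 + L (\<lambda>i. c N s i - 0) / 2"
        using \<rho> by (intro add_mono \<Phi>0 contr s Suc) (auto simp: L_def)
      also have "\<dots> \<le> \<rho> / 2"
        using Suc by simp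
      finally show ?case .
    qed
    have c_step: "L (\<lambda>i. c (Suc N) s i - c N s i) \<le> \<rho> * (1 / 2) ^ N" if s: "norm s < 2" for N s
    proof (induction N)
      case 0
      then show ?case using \<Phi>0 [OF s] \<rho> by (simp add: c_Suc c_0)
    next
      case (Suc N)
      have "L (\<lambda>i. c (Suc (Suc N)) s i - c (Suc N) s i) \<le> L (\<lambda>i. c (Suc N) s i - c N s i) / 2"
        using contr [OF s c_bound [OF s, of "Suc N"] c_bound [OF s, of N]] unfolding c_Suc [symmetric] .
      with Suc show ?case by simp
    qed
    \<comment> \<open>The limit of the iterates, written as a telescoping series so that the
      Weierstrass M-test gives uniform convergence and hence a holomorphic limit.\<close>
    define C where "C s i = (\<Sum>N. c (Suc N) s i - c N s i)" for s i
    have ulim: "uniform_limit (ball 0 2) (\<lambda>N s. c N s i) (\<lambda>s. C s i) sequentially" if i: "i < m" for i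
    proof -
      have "uniform_limit (ball 0 2) (\<lambda>n s. \<Sum>N<n. c (Suc N) s i - c N s i) (\<lambda>s. C s i) sequentially"
        unfolding C_def
      proof (rule Weierstrass_m_test)
        show "norm (c (Suc N) s i - c N s i) \<le> \<rho> * (1 / 2) ^ N" if "s \<in> ball 0 2" for N s
          using le_L [OF i, of "\<lambda>i. c (Suc N) s i - c N s i"] c_step [of s N] that by simp
        show "summable (\<lambda>N. \<rho> * (1 / 2) ^ N)"
          by (intro summable_mult summable_geometric) auto
      qed
      moreover have "(\<Sum>N<n. c (Suc N) s i - c N s i) = c n s i" for n s
        using sum_lessThan_telescope [of "\<lambda>N. c N s i" n] by (simp add: c_0)
      ultimately show ?thesis
        by simp
    qed
    have y_hol: "(\<lambda>s. y s (g s) k) holomorphic_on ball 0 2"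
      if "\<And>i. i < m \<Longrightarrow> (\<lambda>s. g s i) holomorphic_on ball 0 2" for g k
    proof -
      have "(\<lambda>s. if p j = k then g s j else 0) holomorphic_on ball 0 2" if "j < m" for j
        using \<open>j < m\<close> \<open>\<And>i. i < m \<Longrightarrow> (\<lambda>s. g s i) holomorphic_on ball 0 2\<close>
        by (cases "p j = k") auto
      then show ?thesis
        unfolding y_def by (auto intro!: holomorphic_intros)
    qed
    have c_hol: "(\<lambda>s. c N s i) holomorphic_on ball 0 2" if "i < m" for N i
      using that
    proof (induction N arbitrary: i)
      case 0
      then show ?case by (simp add: c_0)
    next
      case (Suc N)
      have "(\<lambda>s. eval (F i) (y s (c N s))) field_differentiable at s" if "s \<in> ball 0 2" for s
      proof -
        have "((\<lambda>s. y s (c N s) k) has_field_derivative deriv (\<lambda>s. y s (c N s) k) s) (at s)" for k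
          using y_hol [OF Suc.IH] that by (intro holomorphic_derivI [where S = "ball 0 2"]) auto
        moreover have "ok (F i) (y s (c N s))"
          using that Suc.prems \<rho>_le [OF Suc.prems]
          by (intro ok_d y_supp order.strict_trans2 [OF y_near] c_bound) auto
        ultimately show ?thesis
          unfolding field_differentiable_def
          by (intro exI, rule has_derivative_eval [where \<gamma> = "\<lambda>s. y s (c N s)", OF _ y_supp])
      qed
      then have "(\<lambda>s. eval (F i) (y s (c N s))) holomorphic_on ball 0 2"
        by (simp add: holomorphic_on_def field_differentiable_at_within)
      then show ?case
        unfolding c_Suc \<Phi>_def using Suc by (intro holomorphic_intros) auto
    qed
    have C_hol: "(\<lambda>s. C s i) holomorphic_on ball 0 2" if "i < m" for i
    proof (rule holomorphic_uniform_sequence [OF open_ball c_hol [OF that]])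
      fix x :: complex assume "x \<in> ball 0 2"
      then obtain e where "e > 0" "cball x e \<subseteq> ball 0 2"
        using open_contains_cball_eq [OF open_ball] by blast
      then show "\<exists>d>0. cball x d \<subseteq> ball 0 2 \<and>
          uniform_limit (cball x d) (\<lambda>N s. c N s i) (\<lambda>s. C s i) sequentially"
        using uniform_limit_on_subset [OF ulim [OF that]] by blast
    qed
    have c_lim: "(\<lambda>N. c N s i) \<longlonglongrightarrow> C s i" if "norm s < 2" "i < m" for s i
      using tendsto_uniform_limitI [OF ulim] that by simp
    have "eval (F i) (y s (C s)) = 0" if s: "norm s < 2" and i: "i < m" for s i
    proof -
      have L_lim: "(\<lambda>N. L (\<lambda>i. c N s i - C s i)) \<longlonglongrightarrow> 0"
      proof -
        have "(\<lambda>N. L (\<lambda>i. c N s i - C s i)) \<longlonglongrightarrow> (\<Sum>i<m. norm (C s i - C s i))"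
          unfolding L_def using s by (intro tendsto_intros c_lim) auto
        then show ?thesis by simp
      qed
      have "(\<lambda>N. L (c N s)) \<longlonglongrightarrow> L (C s)"
        unfolding L_def using s by (intro tendsto_intros c_lim) auto
      then have LC: "L (C s) \<le> \<rho> / 2"
        by (rule Lim_bounded [where M = 0]) (use c_bound [OF s] in blast)
      have "(\<lambda>N. c (Suc N) s i - \<Phi> s (C s) i) \<longlonglongrightarrow> 0"
      proof (rule Lim_null_comparison [OF always_eventually L_lim], rule allI)
        fix N
        have "norm (c (Suc N) s i - \<Phi> s (C s) i) \<le> L (\<lambda>i. \<Phi> s (c N s) i - \<Phi> s (C s) i)"
          unfolding c_Suc by (rule le_L [OF i])
        also have "\<dots> \<le> L (\<lambda>i. c N s i - C s i) / 2"
          by (intro contr s c_bound LC)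
        also have "\<dots> \<le> L (\<lambda>i. c N s i - C s i)"
          using L_nonneg [of "\<lambda>i. c N s i - C s i"] by simp
        finally show "norm (c (Suc N) s i - \<Phi> s (C s) i) \<le> L (\<lambda>i. c N s i - C s i)" .
      qed
      then have "(\<lambda>N. c (Suc N) s i) \<longlonglongrightarrow> \<Phi> s (C s) i"
        by (rule LIM_zero_cancel)
      moreover have "(\<lambda>N. c (Suc N) s i) \<longlonglongrightarrow> C s i"
        using LIMSEQ_Suc [OF c_lim [OF s i]] .
      ultimately have "\<Phi> s (C s) i = C s i"
        by (rule LIMSEQ_unique)
      then show ?thesis
        by (simp add: \<Phi>_def)
    qed
    moreover have y_eq: "y s (C s) = x"
      if line: "\<And>k. z k + s * (w k - z k) = x k" and x: "\<And>i. i < m \<Longrightarrow> eval (F i) x = 0"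
        and s: "norm s < 2" for s x
    proof -
      have yx: "y s c = x" if "\<And>i. i < m \<Longrightarrow> c i = 0" for c
        using that by (auto simp: y_def line fun_eq_iff intro!: sum.neutral)
      have "\<forall>i<m. c N s i = 0" for N
        by (induction N) (auto simp: c_0 c_Suc \<Phi>_def yx x)
      then have "C s i = 0" if "i < m" for i
        using c_lim [OF s that] that by (simp add: LIMSEQ_const_iff)
      then show ?thesis
        by (rule yx)
    qed
    ultimately show "\<exists>\<gamma>. (\<forall>k. (\<lambda>s. \<gamma> s k) holomorphic_on ball 0 2) \<and> \<gamma> 0 = z \<and> \<gamma> 1 = w \<and>
        (\<forall>s. \<gamma> s \<in> supp n) \<and> (\<forall>s\<in>ball 0 2. \<forall>i<m. eval (F i) (\<gamma> s) = 0)"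
      using y_hol [OF C_hol] F(2) Fw
      by (intro exI [of _ "\<lambda>s. y s (C s)"]) (auto intro!: y_eq y_supp)
  qed
qed


subsection \<open>Vanishing to infinite order along curves\<close>

text \<open>The \<open>k\<close>-th entry of the gradient of \<open>g\<close> after reduction modulo the gradients of the \<open>F i\<close>.
  Along a curve on which the \<open>F i\<close> vanish, the derivative of \<open>g\<close> is a combination of these entries.\<close>

definition residual :: "nat \<Rightarrow> (nat \<Rightarrow> tm) \<Rightarrow> (nat \<Rightarrow> nat) \<Rightarrow> nat \<Rightarrow> tm \<Rightarrow> tm" where
  "residual m F p k g = Add (pd k g) (Neg (Sum (\<lambda>i. Mul (pd (p i) g) (pd k (F i))) m))"

section \<open>Maximal families with independent gradients\<close>

lemma pivotal_le:
  assumes "pivotal n z m F p"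
  shows "m \<le> n"
proof -
  \<comment> \<open>The identity block forces distinct pivot columns.\<close>
  have "inj_on p {..<m}"
    using assms unfolding pivotal_def by (intro inj_onI) (metis lessThan_iff zero_neq_one)
  moreover have "p ` {..<m} \<subseteq> {..<n}"
    using assms by (auto simp: pivotal_def)
  ultimately show ?thesis
    using card_inj_on_le [of p "{..<m}" "{..<n}"] by simp
qed

lemma ok_residual: "ok g z \<Longrightarrow> pivotal n z m F p \<Longrightarrow> ok (residual m F p k g) z"
  by (auto simp: residual_def ok_Sum pivotal_def intro!: ok_pd)

text \<open>A step of Gaussian elimination: \<open>g1\<close> clears the pivot columns of
  \<open>g\<close>, \<open>g2\<close> normalises column \<open>k\<close>, and \<open>F'\<close>
  clears column \<open>k\<close> of the old terms. The coefficients are terms, so the result stays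
  in the countable language; their derivatives do not contribute at \<open>z\<close>, being
  multiplied by terms that vanish there.\<close>

lemma pivotal_extend:
  assumes piv: "pivotal n z m F p" and g: "ok g z" "eval g z = 0"
    and k: "k < n" "eval (residual m F p k g) z \<noteq> 0"
  shows "\<exists>F' p'. pivotal n z (Suc m) F' p'"
proof -
  define g1 where "g1 = Add g (Neg (Sum (\<lambda>i. Mul (pd (p i) g) (F i)) m))"
  define g2 where "g2 = Mul (Inv (pd k g1)) g1"
  have F: "ok (F i) z" "eval (F i) z = 0" "p i < n" if "i < m" for i
    using piv that by (auto simp: pivotal_def)
  have pivot: "eval (pd (p j) (F i)) z = (if i = j then 1 else 0)" if "i < m" "j < m" for i j
    using piv that by (auto simp: pivotal_def)
  have g1: "ok g1 z" "eval g1 z = 0"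
    using g F by (auto simp: g1_def ok_Sum eval_Sum intro!: ok_pd)
  have pd_g1: "eval (pd l g1) z = eval (residual m F p l g) z" for l
    using F by (simp add: g1_def residual_def pd_Sum eval_Sum)
  have pd_g1_pivot: "eval (pd (p j) g1) z = 0" if "j < m" for j
  proof -
    have "(\<Sum>i<m. eval (pd (p i) g) z * eval (pd (p j) (F i)) z) = (\<Sum>i<m. if i = j then eval (pd (p j) g) z else 0)"
      by (intro sum.cong) (auto simp: pivot that)
    then show ?thesis
      using that by (simp add: pd_g1 residual_def eval_Sum)
  qed
  have g2: "ok g2 z" "eval g2 z = 0"
    using g1 k(2) by (auto simp: g2_def pd_g1 intro: ok_pd)
  have pd_g2: "eval (pd l g2) z = eval (pd l g1) z / eval (pd k g1) z" for l
    using g1 by (simp add: g2_def field_simps)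
  define F' where "F' i = (if i < m then Add (F i) (Neg (Mul (pd k (F i)) g2)) else g2)" for i
  define p' where "p' i = (if i < m then p i else k)" for i
  have "pivotal n z (Suc m) F' p'"
    unfolding pivotal_def
  proof (intro allI impI conjI)
    fix i assume i: "i < Suc m"
    show "ok (F' i) z" "eval (F' i) z = 0" "p' i < n"
      using F g2 k by (auto simp: F'_def p'_def intro: ok_pd)
    fix j assume j: "j < Suc m"
    show "eval (pd (p' j) (F' i)) z = (if i = j then 1 else 0)"
      using i j k(2) g2(2) by (auto simp: F'_def p'_def pd_g2 pd_g1_pivot [unfolded pd_g1] pivot pd_g1 less_Suc_eq)
  qed
  then show ?thesis
    by blast
qed

text \<open>Family sizes are bounded by \<open>n\<close>, so some family cannot be extended by one.
  By \<open>pivotal_extend\<close>, the gradient at \<open>z\<close> of every term vanishing there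
  is then a combination of the gradients of the \<open>F i\<close>.\<close>

lemma obtain_maximal_pivotal:
  obtains m F p where "pivotal n z m F p"
    and "\<And>g k. ok g z \<Longrightarrow> eval g z = 0 \<Longrightarrow> k < n \<Longrightarrow> eval (residual m F p k g) z = 0"
proof -
  define P where "P m \<longleftrightarrow> (\<exists>F p. pivotal n z m F p)" for m
  have "P 0"
    by (simp add: P_def pivotal_def)
  moreover have le: "m \<le> n" if "P m" for m
    using that pivotal_le by (auto simp: P_def)
  ultimately obtain m where "P m" "\<not> P (Suc m)"
    by (metis dec_induct le_add1 not_less_eq_eq zero_le)
  then show ?thesis
    using that pivotal_extend unfolding P_def by metis
qed

section \<open>Terms along a holomorphic curve in the zero set of a maximal family\<close>

context
  fixes n m z F p \<gamma>
  assumes z: "z \<in> supp n"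
    and piv: "pivotal n z m F p"
    and maximal: "\<And>g k. ok g z \<Longrightarrow> eval g z = 0 \<Longrightarrow> k < n \<Longrightarrow> eval (residual m F p k g) z = 0"
    and \<gamma>_hol: "\<And>k. (\<lambda>s. \<gamma> s k) holomorphic_on ball 0 2"
    and \<gamma>_0: "\<gamma> 0 = z"
    and \<gamma>_supp: "\<And>s. \<gamma> s \<in> supp n"
    and \<gamma>_zero: "\<And>s i. s \<in> ball 0 2 \<Longrightarrow> i < m \<Longrightarrow> eval (F i) (\<gamma> s) = 0"
begin

lemma eventually_ball2: "eventually (\<lambda>s :: complex. s \<in> ball 0 2) (nhds 0)"
  by (intro eventually_nhds_in_open) auto

lemma DERIV_curve:
  "s \<in> ball 0 2 \<Longrightarrow> ((\<lambda>s. \<gamma> s k) has_field_derivative deriv (\<lambda>s. \<gamma> s k) s) (at s)"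
  by (rule holomorphic_derivI [OF \<gamma>_hol open_ball])

lemma filterlim_curve: "filterlim \<gamma> (near n z) (nhds 0)"
proof -
  have "isCont (\<lambda>s. dist1 n z (\<gamma> s)) 0"
    unfolding dist1_def
    by (intro continuous_intros DERIV_isCont [OF DERIV_curve]) auto
  then have "((\<lambda>s. dist1 n z (\<gamma> s)) \<longlongrightarrow> 0) (nhds 0)"
    using tendsto_nhds_iff by (fastforce simp: \<gamma>_0 isCont_def)
  then show ?thesis
    using \<gamma>_supp by (auto simp: near_def filterlim_inf filterlim_filtercomap_iff filterlim_principal o_def)
qed

lemma eventually_ok_curve: "ok g z \<Longrightarrow> eventually (\<lambda>s. ok g (\<gamma> s)) (nhds 0)"
  using filterlim_curve eventually_ok [OF z] by (auto simp: filterlim_iff)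

text \<open>Each \<open>F i\<close> is zero along the curve, so its gradient annihilates the
  velocity. Subtracting multiples of these gradients from that of \<open>g\<close> leaves the
  derivative unchanged.\<close>

lemma eventually_DERIV_eval_curve:
  assumes "ok g z"
  shows "eventually (\<lambda>s. ((\<lambda>s. eval g (\<gamma> s)) has_field_derivative
    (\<Sum>k<n. eval (residual m F p k g) (\<gamma> s) * deriv (\<lambda>s. \<gamma> s k) s)) (at s)) (nhds 0)"
proof -
  have "eventually (\<lambda>s. \<forall>i\<in>{..<m}. ok (F i) (\<gamma> s)) (nhds 0)"
    using piv by (intro eventually_ball_finite ballI eventually_ok_curve) (auto simp: pivotal_def)
  then show ?thesis
    using eventually_ok_curve [OF assms] eventually_ball2
  proof eventually_elim
    case (elim s)
    have "(\<Sum>k<n. eval (pd k (F i)) (\<gamma> s) * deriv (\<lambda>s. \<gamma> s k) s) = 0" if i: "i < m" for i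
    proof (rule DERIV_unique)
      show "((\<lambda>s. eval (F i) (\<gamma> s)) has_field_derivative
          (\<Sum>k<n. eval (pd k (F i)) (\<gamma> s) * deriv (\<lambda>s. \<gamma> s k) s)) (at s)"
        using elim i by (intro has_derivative_eval DERIV_curve \<gamma>_supp) auto
      show "((\<lambda>s. eval (F i) (\<gamma> s)) has_field_derivative 0) (at s)"
        using elim \<gamma>_zero [OF _ i]
        by (intro has_field_derivative_transform_within_open
            [where f = "\<lambda>_. 0" and S = "ball 0 2", OF DERIV_const open_ball]) auto
    qed
    then have "(\<Sum>i<m. eval (pd (p i) g) (\<gamma> s) * (\<Sum>k<n. eval (pd k (F i)) (\<gamma> s) * deriv (\<lambda>s. \<gamma> s k) s)) = 0"
      by (intro sum.neutral) auto
    then have "(\<Sum>k<n. \<Sum>i<m. eval (pd (p i) g) (\<gamma> s) * eval (pd k (F i)) (\<gamma> s) * deriv (\<lambda>s. \<gamma> s k) s) = 0"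
      by (subst sum.swap) (simp add: sum_distrib_left mult.assoc)
    then have eq: "(\<Sum>k<n. eval (residual m F p k g) (\<gamma> s) * deriv (\<lambda>s. \<gamma> s k) s) =
        (\<Sum>k<n. eval (pd k g) (\<gamma> s) * deriv (\<lambda>s. \<gamma> s k) s)"
      by (simp add: residual_def eval_Sum left_diff_distrib sum_subtractf sum_distrib_right)
    show ?case
      unfolding eq by (rule has_derivative_eval [OF DERIV_curve \<gamma>_supp]) (use elim in auto)
  qed
qed

text \<open>By maximality the residuals of a term vanishing at \<open>z\<close> vanish at \<open>z\<close> themselves, so the order of
  vanishing can be raised by integration.\<close>

lemma eval_curve_order:
  assumes "ok g z" "eval g z = 0"
  shows "\<exists>C\<ge>0. eventually (\<lambda>s. norm (eval g (\<gamma> s)) \<le> C * norm s ^ N) (nhds 0)"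
  using assms
proof (induction N arbitrary: g)
  case 0
  have "(eval g \<longlongrightarrow> 0) (near n z)"
    using tendsto_eval [OF z] 0 by metis
  then have "((\<lambda>s. eval g (\<gamma> s)) \<longlongrightarrow> 0) (nhds 0)"
    by (rule filterlim_compose [OF _ filterlim_curve])
  then have "eventually (\<lambda>s. norm (eval g (\<gamma> s)) < 1) (nhds 0)"
    by (auto simp: tendsto_iff)
  then show ?case
    by (intro exI [of _ 1]) (auto elim: eventually_mono)
next
  case (Suc N)
  have "\<exists>C\<ge>0. eventually (\<lambda>s. norm (eval (residual m F p k g) (\<gamma> s)) \<le> C * norm s ^ N) (nhds 0)"
    if "k < n" for k
    using Suc.prems that by (intro Suc.IH ok_residual [OF _ piv] maximal)
  then obtain C where C: "\<And>k. k < n \<Longrightarrow> C k \<ge> 0"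
    "\<And>k. k < n \<Longrightarrow> eventually (\<lambda>s. norm (eval (residual m F p k g) (\<gamma> s)) \<le> C k * norm s ^ N) (nhds 0)"
    by metis
  define B where "B k = norm (deriv (\<lambda>s. \<gamma> s k) 0) + 1" for k
  have B: "eventually (\<lambda>s. norm (deriv (\<lambda>s. \<gamma> s k) s) \<le> B k) (nhds 0)" for k
  proof -
    have "isCont (deriv (\<lambda>s. \<gamma> s k)) 0"
      using holomorphic_deriv [OF \<gamma>_hol open_ball]
      by (auto intro!: continuous_on_interior [of "ball 0 2"] holomorphic_on_imp_continuous_on)
    then have "((\<lambda>s. norm (deriv (\<lambda>s. \<gamma> s k) s)) \<longlongrightarrow> norm (deriv (\<lambda>s. \<gamma> s k) 0)) (nhds 0)"
      using tendsto_nhds_iff by (intro tendsto_norm) (auto simp: isCont_def)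
    then have "eventually (\<lambda>s. norm (deriv (\<lambda>s. \<gamma> s k) s) < B k) (nhds 0)"
      by (rule order_tendstoD) (simp add: B_def)
    then show ?thesis
      by (rule eventually_mono) simp
  qed
  define K where "K = (\<Sum>k<n. C k * B k)"
  have "K \<ge> 0"
    unfolding K_def B_def using C(1) by (intro sum_nonneg) auto
  have "eventually (\<lambda>s. \<forall>k\<in>{..<n}. norm (eval (residual m F p k g) (\<gamma> s)) \<le> C k * norm s ^ N \<and>
      norm (deriv (\<lambda>s. \<gamma> s k) s) \<le> B k) (nhds 0)"
    using B C(2) by (intro eventually_ball_finite ballI eventually_conj) auto
  then have "eventually (\<lambda>s. \<exists>D. ((\<lambda>s. eval g (\<gamma> s)) has_field_derivative D) (at s) \<and> norm D \<le> K * norm s ^ N) (nhds 0)"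
    using eventually_DERIV_eval_curve [OF Suc.prems(1)]
  proof eventually_elim
    case (elim s)
    have "norm (\<Sum>k<n. eval (residual m F p k g) (\<gamma> s) * deriv (\<lambda>s. \<gamma> s k) s) \<le> (\<Sum>k<n. (C k * norm s ^ N) * B k)"
      using elim C(1) by (intro sum_norm_le) (auto simp: norm_mult intro!: mult_mono)
    also have "\<dots> = K * norm s ^ N"
      by (simp add: K_def sum_distrib_right sum_distrib_left mult_ac)
    finally show ?case
      using elim(2) by blast
  qed
  then obtain r where r: "r > 0" "\<And>s. norm s < r \<Longrightarrow>
      \<exists>D. ((\<lambda>s. eval g (\<gamma> s)) has_field_derivative D) (at s) \<and> norm D \<le> K * norm s ^ N"
    by (auto simp: eventually_nhds_metric)
  have "norm (eval g (\<gamma> s)) \<le> K * norm s ^ Suc N" if s: "norm s < r" for s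
  proof -
    have le: "norm x \<le> norm s" if "x \<in> closed_segment 0 s" for x
      using segment_bound1 [OF that] by simp
    from r(2) s le obtain D where D: "\<And>x. x \<in> closed_segment 0 s \<Longrightarrow>
        ((\<lambda>s. eval g (\<gamma> s)) has_field_derivative D x) (at x) \<and> norm (D x) \<le> K * norm x ^ N"
      by (metis le_less_trans)
    have "norm (eval g (\<gamma> s) - eval g (\<gamma> 0)) \<le> (K * norm s ^ N) * norm (s - 0)"
    proof (rule field_differentiable_bound [of "closed_segment 0 s" "\<lambda>s. eval g (\<gamma> s)" D])
      fix x assume x: "x \<in> closed_segment 0 s"
      show "((\<lambda>s. eval g (\<gamma> s)) has_field_derivative D x) (at x within closed_segment 0 s)"
        using D [OF x] by (auto intro: DERIV_subset)
      have "K * norm x ^ N \<le> K * norm s ^ N"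
        using le [OF x] \<open>K \<ge> 0\<close> by (intro mult_left_mono power_mono) auto
      then show "norm (D x) \<le> K * norm s ^ N"
        using D [OF x] by linarith
    qed auto
    then show ?thesis
      using Suc.prems(2) by (simp add: \<gamma>_0 mult_ac)
  qed
  then show ?case
    using \<open>K \<ge> 0\<close> r(1) by (intro exI [of _ K]) (auto simp: eventually_nhds_metric)
qed

text \<open>Were the function nonconstant near 0, it would factor as \<open>s ^ N * h s\<close> with
  \<open>h 0 \<noteq> 0\<close>, but the bound of order \<open>Suc N\<close> forces \<open>h\<close>
  to tend to 0.\<close>

lemma eval_curve_eq_0:
  assumes g: "ok g z" "eval g z = 0"
  shows "eventually (\<lambda>s. eval g (\<gamma> s) = 0) (nhds 0)"
proof -
  define f where "f s = eval g (\<gamma> s)" for s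
  obtain r where r: "r > 0" "\<And>s. s \<in> ball 0 r \<Longrightarrow> f field_differentiable at s"
    using eventually_DERIV_eval_curve [OF g(1)]
    by (auto simp: eventually_nhds_metric f_def [abs_def] field_differentiable_def)
  have hol: "f holomorphic_on ball 0 r"
    using r(2) by (simp add: holomorphic_on_def field_differentiable_at_within)
  have f0: "f 0 = 0"
    by (simp add: f_def \<gamma>_0 g)
  show ?thesis
  proof (cases "f constant_on ball 0 r")
    case True
    then have "f s = 0" if "s \<in> ball 0 r" for s
      using f0 \<open>r > 0\<close> that unfolding constant_on_def by (metis centre_in_ball)
    then show ?thesis
      using \<open>r > 0\<close> by (auto simp: eventually_nhds_metric f_def)
  next
    case False
    obtain h e N where h: "0 < e" "h holomorphic_on ball 0 e"
      "\<And>s. s \<in> ball 0 e \<Longrightarrow> f s = s ^ N * h s" "\<And>s. s \<in> ball 0 e \<Longrightarrow> h s \<noteq> 0"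
      by (rule holomorphic_factor_zero_nonconstant [OF hol open_ball connected_ball _ f0 False]) (use \<open>r > 0\<close> in auto)
    obtain C where C: "eventually (\<lambda>s. norm (f s) \<le> C * norm s ^ Suc N) (nhds 0)"
      using eval_curve_order [OF g, of "Suc N"] by (auto simp: f_def)
    have "isCont h 0"
      using h(1,2) by (auto intro!: continuous_on_interior [of "ball 0 e"] holomorphic_on_imp_continuous_on)
    then have "(h \<longlongrightarrow> h 0) (at 0)"
      by (simp add: isCont_def)
    moreover have "(h \<longlongrightarrow> 0) (at 0)"
    proof (rule Lim_null_comparison)
      have "eventually (\<lambda>s. s \<in> ball 0 e) (at 0)"
        using h(1) by (intro eventually_at_in_open') auto
      moreover have "eventually (\<lambda>s. norm (f s) \<le> C * norm s ^ Suc N) (at 0)"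
        using C by (simp add: eventually_nhds_conv_at)
      moreover have "eventually (\<lambda>s :: complex. s \<noteq> 0) (at 0)"
        by (simp add: eventually_at_filter)
      ultimately show "eventually (\<lambda>s. norm (h s) \<le> C * norm s) (at 0)"
      proof eventually_elim
        case (elim s)
        then have "norm s ^ N * norm (h s) \<le> norm s ^ N * (C * norm s)"
          using h(3) [of s] by (simp add: norm_mult norm_power mult_ac)
        then show ?case
          using elim(3) by (simp add: mult_le_cancel_left_pos)
      qed
      show "((\<lambda>s. C * norm s) \<longlongrightarrow> 0) (at 0)"
        by (auto intro!: tendsto_eq_intros)
    qed
    ultimately have "h 0 = 0"
      using tendsto_unique [of "at (0::complex)"] by (metis trivial_limit_at)
    with h(1,4) show ?thesis
      by simp
  qed
qed

text \<open>The previous lemma is applied to the residuals of \<open>Var q\<close>, not to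
  \<open>Var q\<close> itself: they vanish along the curve near 0, so the coordinate has derivative
  zero there. The identity theorem carries constancy to the whole disc, in particular to parameter
  1.\<close>

lemma curve_coordinate_constant:
  assumes q: "\<And>k. k < n \<Longrightarrow> eval (residual m F p k (Var q)) z = 0" and s: "s \<in> ball 0 2"
  shows "\<gamma> s q = z q"
proof -
  have "eventually (\<lambda>s. \<forall>k\<in>{..<n}. eval (residual m F p k (Var q)) (\<gamma> s) = 0) (nhds 0)"
    using q by (intro eventually_ball_finite ballI eval_curve_eq_0 ok_residual [OF _ piv]) auto
  moreover have "eventually (\<lambda>s. ((\<lambda>s. \<gamma> s q) has_field_derivative
      (\<Sum>k<n. eval (residual m F p k (Var q)) (\<gamma> s) * deriv (\<lambda>s. \<gamma> s k) s)) (at s)) (nhds 0)"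
    using eventually_DERIV_eval_curve [of "Var q"] by simp
  ultimately have "eventually (\<lambda>s. ((\<lambda>s. \<gamma> s q) has_field_derivative 0) (at s)) (nhds 0)"
    by eventually_elim simp
  then have "eventually (\<lambda>s. ((\<lambda>s. \<gamma> s q) has_field_derivative 0) (at s) \<and> s \<in> ball 0 2) (nhds 0)"
    using eventually_ball2 by (rule eventually_conj)
  then obtain r where r: "r > 0"
    "\<And>s. s \<in> ball 0 r \<Longrightarrow> ((\<lambda>s. \<gamma> s q) has_field_derivative 0) (at s) \<and> s \<in> ball 0 2"
    by (auto simp: eventually_nhds_metric)
  then obtain c where c: "\<And>s. s \<in> ball 0 r \<Longrightarrow> \<gamma> s q = c"
    using has_field_derivative_zero_constant [of "ball 0 r" "\<lambda>s. \<gamma> s q"]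
    by (metis convex_ball has_field_derivative_at_within)
  then have "\<gamma> s q = z q" if "s \<in> ball 0 r" for s
    using that \<open>r > 0\<close> \<gamma>_0 by (metis centre_in_ball)
  then show ?thesis
    using analytic_continuation_open [OF open_ball open_ball _ connected_ball _ \<gamma>_hol holomorphic_on_const,
        of 0 r q "z q" s] r s
    by (auto simp: subset_iff)
qed

end

end

subsection \<open>A derivation respecting a family of holomorphic functions\<close>

text \<open>Every value of \<open>f\<close> is the constant value on \<open>S \<inter> b\<close> for
  some member \<open>b\<close> of a countable basis.\<close>

lemma countable_image_locally_constant:
  fixes S :: "'a :: second_countable_topology set"
  assumes "\<And>x. x \<in> S \<Longrightarrow> \<exists>U. open U \<and> x \<in> U \<and> (\<forall>y\<in>S \<inter> U. f y = f x)"
  shows "countable (f ` S)"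
proof -
  obtain B :: "'a set set" where B: "countable B" "topological_basis B"
    using ex_countable_basis by blast
  have "f ` S \<subseteq> (\<lambda>b. f (SOME y. y \<in> S \<inter> b)) ` B"
  proof (rule image_subsetI)
    fix x assume x: "x \<in> S"
    then obtain U where U: "open U" "x \<in> U" "\<And>y. y \<in> S \<inter> U \<Longrightarrow> f y = f x"
      using assms by metis
    then obtain b where b: "b \<in> B" "x \<in> b" "b \<subseteq> U"
      using topological_basisE [OF B(2)] by metis
    have "(SOME y. y \<in> S \<inter> b) \<in> S \<inter> b"
      by (rule someI_ex) (use x b(2) in blast)
    then have "f (SOME y. y \<in> S \<inter> b) = f x"
      using b(3) U(3) by blast
    with b(1) show "f x \<in> (\<lambda>b. f (SOME y. y \<in> S \<inter> b)) ` B"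
      by (metis image_eqI)
  qed
  then show ?thesis
    using countable_image [OF B(1)] by (rule countable_subset)
qed

text \<open>Since \<open>v\<close> lies outside the span of \<open>R\<close>, it can be added to a
  maximal independent subset of \<open>R\<close>, and a functional may be prescribed on the enlarged
  set. Having it vanish on \<open>R\<close> replaces passing to the quotient space.\<close>

lemma exists_separating_functional:
  fixes v :: "'a \<Rightarrow> 'b :: field"
  assumes "\<And>T c. finite T \<Longrightarrow> T \<subseteq> R \<Longrightarrow> v \<noteq> (\<lambda>x. \<Sum>r\<in>T. c r * r x)"
  shows "\<exists>L. (\<forall>f g. L (\<lambda>x. f x + g x) = L f + L g) \<and> (\<forall>f g. L (\<lambda>x. f x - g x) = L f - L g) \<and>
    (\<forall>c f. L (\<lambda>x. c * f x) = c * L f) \<and> (\<forall>r\<in>R. L r = 0) \<and> L v = 1"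
proof -
  define scale where "scale c f = (\<lambda>x. c * f x)" for c and f :: "'a \<Rightarrow> 'b"
  interpret V: vector_space scale
    by standard (auto simp: scale_def fun_eq_iff algebra_simps)
  interpret F: vector_space "(*) :: 'b \<Rightarrow> 'b \<Rightarrow> 'b"
    by standard (auto simp: algebra_simps)
  interpret VF: vector_space_pair scale "(*) :: 'b \<Rightarrow> 'b \<Rightarrow> 'b" ..
  have sum_scale: "(\<Sum>r\<in>T. scale (c r) r) = (\<lambda>x. \<Sum>r\<in>T. c r * r x)" if "finite T" for T c
    using that by (induction T) (auto simp: scale_def fun_eq_iff)
  have "v \<notin> V.span R"
    using assms sum_scale unfolding V.span_explicit by fastforce
  obtain B where B: "B \<subseteq> R" "V.independent B" "R \<subseteq> V.span B"
    by (rule V.maximal_independent_subset)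
  have v: "v \<notin> V.span B"
    using \<open>v \<notin> V.span R\<close> V.span_mono [OF B(1)] by blast
  then have ind: "V.independent (insert v B)"
    using B(2) by (simp add: V.independent_insert)
  obtain L where L: "Vector_Spaces.linear scale (*) L"
    "\<And>x. x \<in> insert v B \<Longrightarrow> L x = (if x = v then 1 else 0)"
    using VF.linear_independent_extend [OF ind, of "\<lambda>x. if x = v then 1 else 0"] by blast
  interpret L: Vector_Spaces.linear scale "(*)" L
    by (fact L(1))
  have "L x = 0" if "x \<in> V.span B" for x
    using that
  proof (rule VF.linear_eq_0_on_span [OF L(1), rotated])
    fix b assume "b \<in> B"
    then have "b \<noteq> v"
      using v V.span_base by blast
    then show "L b = 0"
      using L(2) \<open>b \<in> B\<close> by auto
  qed
  moreover have "L (\<lambda>x. f x + g x) = L f + L g" for f g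
    using L.add [of f g] by (simp add: plus_fun_def)
  moreover have "L (\<lambda>x. f x - g x) = L f - L g" for f g
    using L.diff [of f g] by (simp add: fun_diff_def)
  moreover have "L (\<lambda>x. c * f x) = c * L f" for c f
    using L.scale [of c f] by (simp add: scale_def)
  moreover have "L v = 1"
    using L(2) by simp
  ultimately show ?thesis
    using B(3) by (intro exI [of _ L]) auto
qed

text \<open>The basis vector belonging to the number \<open>a\<close>; the derivation will be
  \<open>L (delta a)\<close> for a functional \<open>L\<close>.\<close>

definition delta :: "complex \<Rightarrow> complex \<Rightarrow> complex" where
  "delta a x = (if x = a then 1 else 0)"

section \<open>Zero sets on which a coordinate is locally constant\<close>

context derivative_family
begin

text \<open>The terms form a list, so that there are only countably many triples
  \<open>(n, q, Fs)\<close>.\<close>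

definition rigid_points :: "nat \<Rightarrow> nat \<Rightarrow> tm list \<Rightarrow> (nat \<Rightarrow> complex) set" where
  "rigid_points n q Fs = {z \<in> supp n. (\<forall>F\<in>set Fs. eval F z = 0) \<and>
     (\<exists>\<delta>>0. \<forall>w\<in>supp n. dist1 n z w < \<delta> \<longrightarrow> (\<forall>F\<in>set Fs. eval F w = 0) \<longrightarrow> w q = z q)}"

lemma countable_rigid_coordinates: "countable ((\<lambda>z. z q) ` rigid_points n q Fs)"
proof (rule countable_image_locally_constant)
  fix z assume z: "z \<in> rigid_points n q Fs"
  then obtain \<delta> where \<delta>: "\<delta> > 0"
    "\<And>w. w \<in> supp n \<Longrightarrow> dist1 n z w < \<delta> \<Longrightarrow> (\<forall>F\<in>set Fs. eval F w = 0) \<Longrightarrow> w q = z q"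
    by (auto simp: rigid_points_def)
  \<comment> \<open>Only finitely many coordinates enter, so the set is open in the product
    topology, which is second countable.\<close>
  have "open {w. dist1 n z w < \<delta>}"
    unfolding dist1_def by (intro open_Collect_less continuous_intros) auto
  with \<delta> show "\<exists>U. open U \<and> z \<in> U \<and> (\<forall>w\<in>rigid_points n q Fs \<inter> U. w q = z q)"
    by (intro exI [of _ "{w. dist1 n z w < \<delta>}"]) (auto simp: rigid_points_def)
qed

text \<open>If gradients of vanishing terms span the unit covector at \<open>q\<close>, so do those
  of a maximal family, and the residuals of \<open>Var q\<close> vanish at \<open>z\<close>. Every
  zero \<open>w\<close> near \<open>z\<close> lies on a curve from \<open>z\<close> in the zero set,
  along which coordinate \<open>q\<close> is constant.\<close>

lemma rigid_point_if_gradient_dependent: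
  assumes z: "z \<in> supp n" and q: "q < n"
    and g: "\<And>r. r \<in> T \<Longrightarrow> ok (g r) z" "\<And>r. r \<in> T \<Longrightarrow> eval (g r) z = 0"
    and c: "\<And>k. k < n \<Longrightarrow> (\<Sum>r\<in>T. c r * eval (pd k (g r)) z) = (if k = q then 1 else 0)"
  shows "\<exists>Fs. z \<in> rigid_points n q Fs"
proof -
  obtain m F p where piv: "pivotal n z m F p"
    and maximal: "\<And>g k. ok g z \<Longrightarrow> eval g z = 0 \<Longrightarrow> k < n \<Longrightarrow> eval (residual m F p k g) z = 0"
    by (rule obtain_maximal_pivotal [where n = n and z = z]) blast
  have F: "ok (F i) z" "eval (F i) z = 0" "p i < n" if "i < m" for i
    using piv that by (auto simp: pivotal_def)
  have res: "eval (residual m F p k (Var q)) z = 0" if k: "k < n" for k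
  proof -
    have "(if k = q then 1 else 0) = (\<Sum>r\<in>T. c r * eval (pd k (g r)) z)"
      using c [OF k] by simp
    also have "\<dots> = (\<Sum>r\<in>T. c r * (\<Sum>i<m. eval (pd (p i) (g r)) z * eval (pd k (F i)) z))"
      using maximal [OF g k] by (intro sum.cong) (auto simp: residual_def eval_Sum)
    also have "\<dots> = (\<Sum>i<m. (\<Sum>r\<in>T. c r * eval (pd (p i) (g r)) z) * eval (pd k (F i)) z)"
      unfolding sum_distrib_left sum_distrib_right by (subst sum.swap) (simp add: mult_ac)
    \<comment> \<open>The coefficient of each \<open>F i\<close> is the unit covector's entry in
      column \<open>p i\<close>, which is also what \<open>residual\<close> uses for
      \<open>Var q\<close>.\<close>
    also have "\<dots> = (\<Sum>i<m. (if p i = q then 1 else 0) * eval (pd k (F i)) z)"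
      using c F by (intro sum.cong) auto
    finally show ?thesis
      by (auto simp: residual_def eval_Sum if_distrib [of "\<lambda>t. eval t z"] eq_commute cong: if_cong)
  qed
  obtain \<delta> where "\<delta> > 0" and \<delta>: "\<forall>w\<in>supp n. dist1 n z w < \<delta> \<longrightarrow> (\<forall>i<m. eval (F i) w = 0) \<longrightarrow>
      (\<exists>\<gamma>. (\<forall>k. (\<lambda>s. \<gamma> s k) holomorphic_on ball 0 2) \<and> \<gamma> 0 = z \<and> \<gamma> 1 = w \<and>
        (\<forall>s. \<gamma> s \<in> supp n) \<and> (\<forall>s\<in>ball 0 2. \<forall>i<m. eval (F i) (\<gamma> s) = 0))"
    using holomorphic_curve_in_zero_set [OF z piv] by (elim exE conjE) (rule that)
  have "w q = z q" if w: "w \<in> supp n" "dist1 n z w < \<delta>" and Fw: "\<forall>i<m. eval (F i) w = 0" for w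
  proof -
    obtain \<gamma> where \<gamma>: "\<forall>k. (\<lambda>s. \<gamma> s k) holomorphic_on ball 0 2" "\<gamma> 0 = z" "\<gamma> 1 = w"
        "\<forall>s. \<gamma> s \<in> supp n" "\<forall>s\<in>ball 0 2. \<forall>i<m. eval (F i) (\<gamma> s) = 0"
      using \<delta> [THEN bspec, OF w(1), THEN mp, OF w(2), THEN mp, OF Fw] by (elim exE conjE) (rule that)
    have "\<gamma> 1 q = z q"
      by (rule curve_coordinate_constant [where \<gamma> = \<gamma>, OF z piv]) (use maximal res \<gamma> in auto)
    then show ?thesis
      by (simp add: \<gamma>(3))
  qed
  moreover have set_iff: "(\<forall>G\<in>set (map F [0..<m]). eval G w = 0) \<longleftrightarrow> (\<forall>i<m. eval (F i) w = 0)" for w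
    by auto
  ultimately have "z \<in> rigid_points n q (map F [0..<m])"
    unfolding rigid_points_def mem_Collect_eq set_iff
    using z F(2) \<open>\<delta> > 0\<close> by (intro conjI exI [of _ \<delta>]) simp_all
  then show ?thesis ..
qed

text \<open>Each requirement on the derivation is a linear equation between its values, recorded as
  the vector that \<open>L\<close> has to annihilate.\<close>

inductive_set relations :: "(complex \<Rightarrow> complex) set" where
  "(\<lambda>x. delta (a + b) x - (delta a x + delta b x)) \<in> relations"
| "(\<lambda>x. delta (a * b) x - (a * delta b x + b * delta a x)) \<in> relations"
| "delta (\<kappa> i) \<in> relations"
| "a \<in> \<Omega> \<Longrightarrow> (\<lambda>x. delta (\<phi> r a) x - \<phi> (Suc r) a * delta a x) \<in> relations"

text \<open>With variables in place of numbers, a relation becomes an equation such as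
  \<open>x l = x i + x j\<close> that holds at \<open>z\<close>, and its gradient has the relation's
  coefficients. Injectivity of \<open>z\<close> lets \<open>delta (z i) (z k)\<close> detect
  \<open>i = k\<close>. As \<open>A\<close> does not depend on \<open>z\<close>, one point can serve
  finitely many relations.\<close>

lemma relation_as_gradient:
  assumes "\<rho> \<in> relations"
  shows "\<exists>A. finite A \<and> (\<forall>n z. inj_on z {..<n} \<longrightarrow> A \<subseteq> z ` {..<n} \<longrightarrow>
    (\<exists>g. ok g z \<and> eval g z = 0 \<and> (\<forall>k<n. eval (pd k g) z = \<rho> (z k))))"
proof -
  have pd_Var: "eval (pd k (Var i)) z = delta (z i) (z k)" if "inj_on z {..<n}" "i < n" "k < n" for i k z n
    using that by (auto simp: delta_def inj_on_def)
  show ?thesis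
    using assms
  proof cases
    case (1 a b)
    show ?thesis
    proof (intro exI [of _ "{a, b, a + b}"] conjI allI impI)
      fix n and z :: "nat \<Rightarrow> complex" assume z: "inj_on z {..<n}" "{a, b, a + b} \<subseteq> z ` {..<n}"
      then obtain i j l where "i < n" "j < n" "l < n" "a = z i" "b = z j" "a + b = z l"
        by (auto simp: image_iff)
      then show "\<exists>g. ok g z \<and> eval g z = 0 \<and> (\<forall>k<n. eval (pd k g) z = \<rho> (z k))"
        by (intro exI [of _ "Add (Var l) (Neg (Add (Var i) (Var j)))"])
          (auto simp: 1 pd_Var [OF z(1)] simp del: pd.simps(1))
    qed auto
  next
    case (2 a b)
    show ?thesis
    proof (intro exI [of _ "{a, b, a * b}"] conjI allI impI)
      fix n and z :: "nat \<Rightarrow> complex" assume z: "inj_on z {..<n}" "{a, b, a * b} \<subseteq> z ` {..<n}"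
      then obtain i j l where "i < n" "j < n" "l < n" "a = z i" "b = z j" "a * b = z l"
        by (auto simp: image_iff)
      then show "\<exists>g. ok g z \<and> eval g z = 0 \<and> (\<forall>k<n. eval (pd k g) z = \<rho> (z k))"
        by (intro exI [of _ "Add (Var l) (Neg (Mul (Var i) (Var j)))"])
          (auto simp: 2 pd_Var [OF z(1)] simp del: pd.simps(1))
    qed auto
  next
    case (3 j)
    show ?thesis
    proof (intro exI [of _ "{\<kappa> j}"] conjI allI impI)
      fix n and z :: "nat \<Rightarrow> complex" assume z: "inj_on z {..<n}" "{\<kappa> j} \<subseteq> z ` {..<n}"
      then obtain i where "i < n" "\<kappa> j = z i"
        by auto
      then show "\<exists>g. ok g z \<and> eval g z = 0 \<and> (\<forall>k<n. eval (pd k g) z = \<rho> (z k))"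
        by (intro exI [of _ "Add (Var i) (Neg (Cst j))"])
          (auto simp: 3 pd_Var [OF z(1)] simp del: pd.simps(1))
    qed auto
  next
    case (4 a r)
    show ?thesis
    proof (intro exI [of _ "{a, \<phi> r a}"] conjI allI impI)
      fix n and z :: "nat \<Rightarrow> complex" assume z: "inj_on z {..<n}" "{a, \<phi> r a} \<subseteq> z ` {..<n}"
      then obtain i l where "i < n" "l < n" "a = z i" "\<phi> r a = z l"
        by (auto simp: image_iff)
      then show "\<exists>g. ok g z \<and> eval g z = 0 \<and> (\<forall>k<n. eval (pd k g) z = \<rho> (z k))"
        using 4 by (intro exI [of _ "Add (Var l) (Neg (App r (Var i)))"])
          (auto simp: pd_Var [OF z(1)] simp del: pd.simps(1))
    qed auto
  qed
qed

theorem exists_nontrivial_derivation: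
  "\<exists>D t. derivation D \<and> D t \<noteq> 0 \<and> (\<forall>i. D (\<kappa> i) = 0) \<and>
     (\<forall>r. \<forall>z\<in>\<Omega>. D (\<phi> r z) = \<phi> (Suc r) z * D z)"
proof -
  \<comment> \<open>All numbers occurring as a rigid coordinate, over all dimensions, indices and
    lists of terms.\<close>
  define X where "X = (\<Union>(n, q, Fs)\<in>UNIV. (\<lambda>z. z q) ` rigid_points n q Fs)"
  have "countable X"
    unfolding X_def by (intro countable_UN) (auto intro: countable_rigid_coordinates)
  then have "X \<noteq> UNIV"
    using uncountable_UNIV_complex by auto
  then obtain t where t: "t \<notin> X"
    by auto
  have indep: "delta t \<noteq> (\<lambda>x. \<Sum>\<rho>\<in>T. c \<rho> * \<rho> x)" if T: "finite T" "T \<subseteq> relations" for T c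
  proof
    assume eq: "delta t = (\<lambda>x. \<Sum>\<rho>\<in>T. c \<rho> * \<rho> x)"
    define G where "G \<rho> A \<longleftrightarrow> finite A \<and> (\<forall>n z. inj_on z {..<n} \<longrightarrow> A \<subseteq> z ` {..<n} \<longrightarrow>
        (\<exists>g. ok g z \<and> eval g z = 0 \<and> (\<forall>k<n. eval (pd k g) z = \<rho> (z k))))" for \<rho> A
    have "\<exists>A. G \<rho> A" if "\<rho> \<in> T" for \<rho>
      unfolding G_def using T(2) that by (intro relation_as_gradient) auto
    then obtain A where A: "\<And>\<rho>. \<rho> \<in> T \<Longrightarrow> G \<rho> (A \<rho>)"
      by metis
    \<comment> \<open>\<open>t\<close> and all numbers in the relations of \<open>T\<close> are
      enumerated without repetition as the coordinates of a single point.\<close>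
    define U where "U = insert t (\<Union>\<rho>\<in>T. A \<rho>)"
    have "finite U"
      using T(1) A by (simp add: U_def G_def)
    then obtain e where e: "bij_betw e {..<card U} U"
      using ex_bij_betw_nat_finite by (metis atLeast0LessThan)
    define n where "n = card U"
    define z where "z k = (if k < n then e k else 0)" for k
    have z: "z \<in> supp n"
      by (simp add: z_def supp_def)
    have inj: "inj_on z {..<n}" and img: "z ` {..<n} = U"
      using e by (auto simp: z_def n_def bij_betw_def inj_on_def)
    obtain q where q: "q < n" "z q = t"
    proof -
      have "t \<in> z ` {..<n}"
        by (simp add: img U_def)
      then show ?thesis
        using that by auto
    qed
    have "\<forall>\<rho>\<in>T. \<exists>g. ok g z \<and> eval g z = 0 \<and> (\<forall>k<n. eval (pd k g) z = \<rho> (z k))"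
    proof
      fix \<rho> assume \<rho>: "\<rho> \<in> T"
      then have "A \<rho> \<subseteq> z ` {..<n}"
        by (auto simp: img U_def)
      with A [OF \<rho>] inj show "\<exists>g. ok g z \<and> eval g z = 0 \<and> (\<forall>k<n. eval (pd k g) z = \<rho> (z k))"
        unfolding G_def by blast
    qed
    then obtain g where g: "\<And>\<rho>. \<rho> \<in> T \<Longrightarrow> ok (g \<rho>) z" "\<And>\<rho>. \<rho> \<in> T \<Longrightarrow> eval (g \<rho>) z = 0"
      "\<And>\<rho> k. \<rho> \<in> T \<Longrightarrow> k < n \<Longrightarrow> eval (pd k (g \<rho>)) z = \<rho> (z k)"
      by metis
    \<comment> \<open>Evaluating \<open>eq\<close> at the number \<open>z k\<close> gives entry
      \<open>k\<close> of the combined gradients; as coordinates are distinct, only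
      \<open>k = q\<close> gives \<open>t\<close>.\<close>
    have grad: "(\<Sum>\<rho>\<in>T. c \<rho> * eval (pd k (g \<rho>)) z) = (if k = q then 1 else 0)" if k: "k < n" for k
    proof -
      have "(\<Sum>\<rho>\<in>T. c \<rho> * eval (pd k (g \<rho>)) z) = delta t (z k)"
        unfolding eq using k by (intro sum.cong) (auto simp: g)
      also have "\<dots> = (if k = q then 1 else 0)"
        using inj k q by (auto simp: delta_def inj_on_def)
      finally show ?thesis .
    qed
    have "\<exists>Fs. z \<in> rigid_points n q Fs"
      by (rule rigid_point_if_gradient_dependent [where T = T and g = g and c = c]) (fact z q(1) g grad)+
    then obtain Fs where "z \<in> rigid_points n q Fs" ..
    then have "z q \<in> X"
      by (auto simp: X_def)
    with t q(2) show False
      by simp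
  qed
  have "\<exists>L. (\<forall>f g. L (\<lambda>x. f x + g x) = L f + L g) \<and> (\<forall>f g. L (\<lambda>x. f x - g x) = L f - L g) \<and>
    (\<forall>c f. L (\<lambda>x. c * f x) = c * L f) \<and> (\<forall>r\<in>relations. L r = 0) \<and> L (delta t) = 1"
    by (rule exists_separating_functional) (rule indep)
  then obtain L :: "(complex \<Rightarrow> complex) \<Rightarrow> complex"
    where L': "\<forall>f g. L (\<lambda>x. f x + g x) = L f + L g" "\<forall>f g. L (\<lambda>x. f x - g x) = L f - L g"
      "\<forall>c f. L (\<lambda>x. c * f x) = c * L f" "\<forall>r\<in>relations. L r = 0" "L (delta t) = 1"
    by (elim exE conjE) (rule that)
  note L = L' [rule_format]
  have "derivation (\<lambda>a. L (delta a))"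
    unfolding derivation_def
    using L(4) [OF relations.intros(1)] L(4) [OF relations.intros(2)] by (simp add: L(1-3))
  moreover have "L (delta (\<phi> r z)) = \<phi> (Suc r) z * L (delta z)" if "z \<in> \<Omega>" for r z
    using L(4) [OF relations.intros(4) [OF that]] by (simp add: L(2,3))
  ultimately show ?thesis
    using L(5) L(4) [OF relations.intros(3)]
    by (intro exI [of _ "\<lambda>a. L (delta a)"] exI [of _ t]) auto
qed

end

subsection \<open>Holomorphy of the j-function\<close>

lemma summable_on_inverse_one_plus_square:
  "(\<lambda>m :: int. 1 / (1 + (of_int m)\<^sup>2) :: real) summable_on UNIV"
proof -
  have "summable (\<lambda>n :: nat. 1 / (1 + (of_nat n)\<^sup>2) :: real)"
  proof (rule summable_comparison_test_ev [OF _ inverse_power_summable [of 2]])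
    show "eventually (\<lambda>n. norm (1 / (1 + (of_nat n)\<^sup>2) :: real) \<le> inverse (of_nat n ^ 2)) sequentially"
      using eventually_gt_at_top [of 0] by eventually_elim (auto simp: inverse_eq_divide intro!: divide_left_mono mult_pos_pos add_pos_nonneg)
  qed simp
  then have nat: "(\<lambda>n :: nat. 1 / (1 + (of_nat n)\<^sup>2) :: real) summable_on UNIV"
    by (subst summable_on_UNIV_nonneg_real_iff) auto
  have "(\<lambda>m :: int. 1 / (1 + (of_int m)\<^sup>2) :: real) summable_on (range int)"
    using nat by (subst summable_on_reindex) (auto simp: o_def)
  moreover have "(\<lambda>m :: int. 1 / (1 + (of_int m)\<^sup>2) :: real) summable_on (range (\<lambda>n. - int n))"
    using nat by (subst summable_on_reindex) (auto simp: o_def inj_on_def)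
  ultimately have "(\<lambda>m :: int. 1 / (1 + (of_int m)\<^sup>2) :: real) summable_on (range int \<union> range (\<lambda>n. - int n))"
    by (rule summable_on_union)
  moreover have "range int \<union> range (\<lambda>n. - int n) = UNIV"
    by (auto simp: image_iff) (metis int_cases2)
  ultimately show ?thesis
    by simp
qed

lemma summable_on_inverse_one_plus_squares:
  "(\<lambda>(m :: int, n :: int). 1 / ((1 + (of_int m)\<^sup>2) * (1 + (of_int n)\<^sup>2)) :: real) summable_on UNIV"
proof -
  define f :: "int \<Rightarrow> real" where "f m = 1 / (1 + (of_int m)\<^sup>2)" for m
  have f: "(f has_sum infsum f UNIV) UNIV"
    unfolding f_def [abs_def] by (intro has_sum_infsum summable_on_inverse_one_plus_square)
  have "(\<lambda>(m, n). f m * f n) summable_on (UNIV \<times> UNIV)"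
  proof (rule summable_on_SigmaI)
    show "((\<lambda>n. case (m, n) of (m, n) \<Rightarrow> f m * f n) has_sum f m * infsum f UNIV) UNIV" for m
      using has_sum_cmult_right [OF f] by simp
    show "(\<lambda>m. f m * infsum f UNIV) summable_on UNIV"
      using f by (intro summable_on_cmult_left) (auto dest: has_sum_imp_summable)
  qed (auto simp: f_def)
  then show ?thesis
    by (simp add: f_def)
qed

text \<open>The imaginary part controls \<open>n\<close>, and then the real part controls
  \<open>m\<close>. The constant depends only on the bounds \<open>X\<close> and \<open>Y\<close>,
  as a majorant uniform in \<open>z\<close> requires.\<close>

lemma lattice_norm_lower_bound:
  fixes m n :: int
  assumes "\<bar>Re z\<bar> \<le> X" "Im z \<ge> Y" "Y > 0"
  shows "(of_int m)\<^sup>2 + (of_int n)\<^sup>2 \<le> (2 + (2 * X\<^sup>2 + 1) / Y\<^sup>2) * (norm (of_int m + of_int n * z))\<^sup>2"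
proof -
  define a b where "a = of_int m + of_int n * Re z" and "b = of_int n * Im z"
  have norm: "(norm (of_int m + of_int n * z))\<^sup>2 = a\<^sup>2 + b\<^sup>2"
    by (simp add: cmod_power2 a_def b_def)
  have "(of_int n)\<^sup>2 * Y\<^sup>2 \<le> (of_int n)\<^sup>2 * (Im z)\<^sup>2"
    using assms by (intro mult_left_mono power_mono) auto
  then have n: "(of_int n)\<^sup>2 \<le> b\<^sup>2 / Y\<^sup>2"
    using assms by (simp add: b_def power_mult_distrib pos_le_divide_eq)
  have "(of_int m)\<^sup>2 = (a - of_int n * Re z)\<^sup>2"
    by (simp add: a_def)
  also have "\<dots> \<le> 2 * a\<^sup>2 + 2 * (of_int n * Re z)\<^sup>2"
    using zero_le_power2 [of "a + of_int n * Re z"] by (simp add: power2_eq_square algebra_simps)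
  also have "(of_int n * Re z)\<^sup>2 \<le> (of_int n)\<^sup>2 * X\<^sup>2"
    unfolding power_mult_distrib using assms(1)
    by (intro mult_left_mono) (auto simp: abs_le_square_iff [symmetric])
  also have "\<dots> \<le> b\<^sup>2 / Y\<^sup>2 * X\<^sup>2"
    by (intro mult_right_mono n) auto
  finally have "(of_int m)\<^sup>2 + (of_int n)\<^sup>2 \<le> 2 * a\<^sup>2 + (2 * X\<^sup>2 + 1) / Y\<^sup>2 * b\<^sup>2"
    using n by (simp add: algebra_simps add_divide_distrib)
  also have "\<dots> \<le> (2 + (2 * X\<^sup>2 + 1) / Y\<^sup>2) * (a\<^sup>2 + b\<^sup>2)"
    by (simp add: distrib_left distrib_right)
  finally show ?thesis
    by (simp add: norm)
qed

text \<open>On a closed disc the fourth power of \<open>2 * K * t\<close>, where \<open>t\<close> is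
  the norm of the lattice point, dominates \<open>(1 + m^2) * (1 + n^2)\<close>. This gives a
  summable majorant and a locally uniform limit of holomorphic finite sums.\<close>

lemma holomorphic_lattice_sum:
  assumes "k \<ge> 4"
  shows "lattice_sum k holomorphic_on {z. Im z > 0}"
proof -
  have "\<exists>e>0. lattice_sum k holomorphic_on ball z0 e" if z0: "Im z0 > 0" for z0
  proof -
    define e Y X where "e = Im z0 / 2" and "Y = Im z0 / 2" and "X = \<bar>Re z0\<bar> + Im z0 / 2"
    have "e > 0" "Y > 0"
      using z0 by (auto simp: e_def Y_def)
    have box: "\<bar>Re z\<bar> \<le> X" "Im z \<ge> Y" if "z \<in> cball z0 e" for z
    proof -
      have "\<bar>Re (z0 - z)\<bar> \<le> e" "\<bar>Im (z0 - z)\<bar> \<le> e"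
        using that abs_Re_le_cmod [of "z0 - z"] abs_Im_le_cmod [of "z0 - z"] by (auto simp: dist_norm)
      then show "\<bar>Re z\<bar> \<le> X" "Im z \<ge> Y"
        unfolding X_def Y_def e_def minus_complex.sel by arith+
    qed
    define K where "K = 2 + (2 * X\<^sup>2 + 1) / Y\<^sup>2"
    have "K \<ge> 1"
      using \<open>Y > 0\<close> by (simp add: K_def)
    define M :: "int \<times> int \<Rightarrow> real" where
      "M = (\<lambda>(m, n). (2 * K) ^ k * (1 / ((1 + (of_int m)\<^sup>2) * (1 + (of_int n)\<^sup>2))))"
    define A :: "(int \<times> int) set" where "A = UNIV - {(0, 0)}"
    define f where "f = (\<lambda>(m, n) z. 1 / (of_int m + of_int n * z :: complex) ^ k)"
    \<comment> \<open>Away from the origin \<open>m^2 + n^2\<close> is at least 1, so the extra 1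
      costs only a factor 2.\<close>
    have lower: "(1 + (of_int m)\<^sup>2) + (of_int n)\<^sup>2 \<le> 2 * K * (norm (of_int m + of_int n * z))\<^sup>2"
      if "(m, n) \<in> A" "z \<in> cball z0 e" for m n z
    proof -
      have "(1 :: real) \<le> (of_int m)\<^sup>2 + (of_int n)\<^sup>2"
      proof -
        have "m\<^sup>2 + n\<^sup>2 > 0"
          using that(1) by (auto simp: A_def sum_power2_gt_zero_iff)
        then have "real_of_int 1 \<le> real_of_int (m\<^sup>2 + n\<^sup>2)"
          by linarith
        then show ?thesis by simp
      qed
      then show ?thesis
        using lattice_norm_lower_bound [OF box [OF that(2)] \<open>Y > 0\<close>, of m n] unfolding K_def [symmetric] by linarith
    qed
    have pos: "norm (of_int m + of_int n * z) > 0" if "(m, n) \<in> A" "z \<in> cball z0 e" for m n z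
      using lower [OF that] by (auto simp: add_pos_nonneg dest!: order.strict_trans2 [rotated])
    have bound: "norm (f x z) \<le> M x" if x: "x \<in> A" and z: "z \<in> cball z0 e" for x z
    proof -
      obtain m n where [simp]: "x = (m, n)" by (cases x)
      define t :: real where "t = norm (of_int m + of_int n * z)"
      have t: "t > 0" "(1 + (of_int m)\<^sup>2) + (of_int n)\<^sup>2 \<le> 2 * K * t\<^sup>2"
        using x z lower pos by (auto simp: t_def)
      have "1 \<le> (1 + (of_int m)\<^sup>2) + (of_int n :: real)\<^sup>2"
        by simp
      also note t(2)
      also have "2 * K * t\<^sup>2 \<le> (2 * K * t)\<^sup>2"
      proof -
        have "2 * K * 1 * t\<^sup>2 \<le> 2 * K * (2 * K) * t\<^sup>2"
          using \<open>K \<ge> 1\<close> by (intro mult_right_mono mult_left_mono) auto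
        then show ?thesis by (simp add: power2_eq_square mult_ac)
      qed
      \<comment> \<open>This permits raising the exponent from 4 to \<open>k\<close> below.\<close>
      finally have "1 \<le> 2 * K * t"
        using t(1) \<open>K \<ge> 1\<close> by (intro power2_le_imp_le [of 1 "2 * K * t"]) auto
      have "(1 + (of_int m)\<^sup>2) * (1 + (of_int n :: real)\<^sup>2) \<le> ((1 + (of_int m)\<^sup>2) + (of_int n)\<^sup>2)\<^sup>2"
      proof -
        have "a * (1 + b) \<le> (a + b)\<^sup>2" if "a \<ge> 1" "b \<ge> 0" for a b :: real
          using mult_left_mono [of 1 a a] mult_nonneg_nonneg [of a b] that
          by (simp add: power2_eq_square algebra_simps add_increasing2)
        then show ?thesis
          by simp
      qed
      also have "\<dots> \<le> (2 * K * t\<^sup>2)\<^sup>2"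
        by (intro power_mono t) auto
      also have "\<dots> \<le> ((2 * K * t)\<^sup>2)\<^sup>2"
        using \<open>2 * K * t\<^sup>2 \<le> (2 * K * t)\<^sup>2\<close> \<open>K \<ge> 1\<close> by (intro power_mono) auto
      also have "\<dots> = (2 * K * t) ^ 4"
        by (simp flip: power_mult)
      also have "\<dots> \<le> (2 * K * t) ^ k"
        using assms \<open>1 \<le> 2 * K * t\<close> by (rule power_increasing)
      also have "\<dots> = (2 * K) ^ k * t ^ k"
        by (simp add: power_mult_distrib)
      finally have "(1 + (of_int m)\<^sup>2) * (1 + (of_int n :: real)\<^sup>2) \<le> (2 * K) ^ k * t ^ k" .
      moreover have "(1 + (of_int m)\<^sup>2) * (1 + (of_int n :: real)\<^sup>2) > 0"
        by (intro mult_pos_pos add_pos_nonneg) auto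
      moreover have "1 / x \<le> a * (1 / p)" if "p \<le> a * x" "p > 0" "x > 0" for a p x :: real
        using that by (simp add: field_simps)
      ultimately have "1 / t ^ k \<le> M x"
        using t(1) by (simp add: M_def)
      then show ?thesis
        by (simp add: f_def norm_divide norm_power t_def)
    qed
    have "M summable_on UNIV"
      using summable_on_cmult_right [OF summable_on_inverse_one_plus_squares, of "(2 * K) ^ k"]
      by (simp add: M_def case_prod_unfold)
    then have "M summable_on A"
      by (rule summable_on_subset_banach) simp
    then have ulim: "uniform_limit (cball z0 e) (\<lambda>X z. \<Sum>x\<in>X. f x z) (\<lambda>z. \<Sum>\<^sub>\<infinity>x\<in>A. f x z) (finite_subsets_at_top A)"
      using bound by (intro Weierstrass_m_test_general)
    have hol: "(\<lambda>z. \<Sum>x\<in>X. f x z) holomorphic_on cball z0 e" if "X \<subseteq> A" for X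
      using that pos by (intro holomorphic_on_sum) (fastforce simp: f_def intro!: holomorphic_intros)
    have "eventually (\<lambda>X. continuous_on (cball z0 e) (\<lambda>z. \<Sum>x\<in>X. f x z) \<and>
        (\<lambda>z. \<Sum>x\<in>X. f x z) holomorphic_on ball z0 e) (finite_subsets_at_top A)"
      using hol by (intro eventually_finite_subsets_at_top_weakI)
        (auto intro: holomorphic_on_imp_continuous_on holomorphic_on_subset [OF _ ball_subset_cball])
    then have "(\<lambda>z. \<Sum>\<^sub>\<infinity>x\<in>A. f x z) holomorphic_on ball z0 e"
      by (rule holomorphic_uniform_limit [OF _ ulim]) auto
    moreover have "(\<lambda>z. \<Sum>\<^sub>\<infinity>x\<in>A. f x z) = lattice_sum k"
      by (simp add: lattice_sum_def A_def f_def fun_eq_iff case_prod_unfold)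
    ultimately show ?thesis
      using \<open>e > 0\<close> by auto
  qed
  then show ?thesis
    unfolding holomorphic_on_def
    by (metis (mono_tags) at_within_open centre_in_ball field_differentiable_at_within mem_Collect_eq open_ball)
qed

text \<open>The discriminant is holomorphic on the connected upper half plane. Either it is
  identically zero, and \<open>klein_j\<close> is 0 because division by zero yields 0, or its zeros
  are countable and can be removed.\<close>

lemma klein_j_holomorphic_except_countable:
  obtains U where "open U" "U \<subseteq> {z. Im z > 0}" "countable ({z. Im z > 0} - U)"
    "klein_j holomorphic_on U"
proof -
  define H where "H = {z. Im z > 0}"
  have H: "open H" "connected H"
    by (auto simp: H_def open_halfspace_Im_gt convex_halfspace_Im_gt convex_connected)
  \<comment> \<open>A hypothesis of \<open>holomorphic_countable_zeros\<close>, met by exhausting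
    \<open>H\<close> with closed half planes.\<close>
  have "fsigma H"
  proof -
    have "H = (\<Union>n::nat. {z. Im z \<ge> 1 / of_nat (Suc n)})"
    proof (intro equalityI subsetI)
      fix z assume "z \<in> H"
      then obtain n where "inverse (of_nat (Suc n)) < Im z"
        using reals_Archimedean [of "Im z"] by (auto simp: H_def)
      then show "z \<in> (\<Union>n::nat. {z. Im z \<ge> 1 / of_nat (Suc n)})"
        by (auto simp: inverse_eq_divide intro!: exI [of _ n])
    next
      fix z assume "z \<in> (\<Union>n::nat. {z. Im z \<ge> 1 / of_nat (Suc n)})"
      then show "z \<in> H"
        by (auto simp: H_def intro: less_le_trans [rotated])
    qed
    then show ?thesis
      using fsigma.intros [of "\<lambda>n. {z. Im z \<ge> 1 / of_nat (Suc n)}"] closed_halfspace_Im_ge by simp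
  qed
  define \<Delta> where "\<Delta> z = g2 z ^ 3 - 27 * g3 z ^ 2" for z
  have hol: "g2 holomorphic_on H" "\<Delta> holomorphic_on H"
    unfolding H_def \<Delta>_def g2_def g3_def by (intro holomorphic_intros holomorphic_lattice_sum; simp)+
  show ?thesis
  proof (cases "\<forall>z\<in>H. \<Delta> z = 0")
    case True
    then have "klein_j holomorphic_on H \<longleftrightarrow> (\<lambda>z. 0 :: complex) holomorphic_on H"
      by (intro holomorphic_cong) (auto simp: klein_j_def \<Delta>_def)
    then show ?thesis
      using H(1) by (intro that [of H]) (simp_all add: H_def)
  next
    case False
    define U where "U = {z\<in>H. \<Delta> z \<noteq> 0}"
    have "open U"
    proof -
      have "open (H \<inter> \<Delta> -` (- {0}))"
        using hol(2) H(1) by (intro continuous_open_preimage holomorphic_on_imp_continuous_on) auto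
      moreover have "H \<inter> \<Delta> -` (- {0}) = U"
        by (auto simp: U_def)
      ultimately show ?thesis by simp
    qed
    moreover have "countable (H - U)"
    proof (cases "\<Delta> constant_on H")
      case True
      with False have "H - U = {}"
        by (auto simp: constant_on_def U_def)
      then show ?thesis by (metis countable_empty)
    next
      case False
      have "H - U = {z\<in>H. \<Delta> z = 0}"
        by (auto simp: U_def)
      then show ?thesis
        using holomorphic_countable_zeros [OF hol(2) H \<open>fsigma H\<close> False] by simp
    qed
    moreover have "klein_j holomorphic_on U"
    proof -
      have "(\<lambda>z. 1728 * g2 z ^ 3 / \<Delta> z) holomorphic_on U"
        using hol by (intro holomorphic_intros) (auto simp: U_def intro: holomorphic_on_subset)
      then show ?thesis
        by (simp add: klein_j_def [abs_def] \<Delta>_def)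
    qed
    moreover have "U \<subseteq> H"
      by (auto simp: U_def)
    ultimately show ?thesis
      by (intro that [of U]) (simp_all add: H_def)
  qed
qed

text \<open>Conjugating both argument and value preserves holomorphy, so the lower half plane
  contributes the mirror image of the exceptional set.\<close>

lemma j_fun_holomorphic_except_countable:
  obtains \<Omega> where "open \<Omega>" "countable ({z. Im z \<noteq> 0} - \<Omega>)" "j_fun holomorphic_on \<Omega>"
proof -
  obtain U where U: "open U" "U \<subseteq> {z. Im z > 0}" "countable ({z. Im z > 0} - U)"
    "klein_j holomorphic_on U"
    by (rule klein_j_holomorphic_except_countable)
  have "open (cnj ` U)"
    unfolding image_cnj_conv_vimage_cnj using U(1) by (intro open_vimage) (auto intro: continuous_intros)
  have "j_fun holomorphic_on U \<longleftrightarrow> klein_j holomorphic_on U"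
    using U(2) by (intro holomorphic_cong) (auto simp: j_fun_def)
  moreover have "j_fun holomorphic_on cnj ` U \<longleftrightarrow> (cnj \<circ> klein_j \<circ> cnj) holomorphic_on cnj ` U"
    using U(2) by (intro holomorphic_cong) (fastforce simp: j_fun_def)+
  moreover have "(cnj \<circ> klein_j \<circ> cnj) holomorphic_on cnj ` U"
    using U(4) \<open>open (cnj ` U)\<close> by (intro holomorphic_on_compose_cnj_cnj) (auto simp: image_image)
  ultimately have "j_fun holomorphic_on U \<union> cnj ` U"
    using U(1,4) \<open>open (cnj ` U)\<close> by (intro holomorphic_on_Un) auto
  moreover have "countable ({z. Im z \<noteq> 0} - (U \<union> cnj ` U))"
  proof (rule countable_subset)
    show "{z. Im z \<noteq> 0} - (U \<union> cnj ` U) \<subseteq> ({z. Im z > 0} - U) \<union> cnj ` ({z. Im z > 0} - U)"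
    proof
      fix z assume z: "z \<in> {z. Im z \<noteq> 0} - (U \<union> cnj ` U)"
      show "z \<in> ({z. Im z > 0} - U) \<union> cnj ` ({z. Im z > 0} - U)"
      proof (cases "Im z > 0")
        case False
        then have "cnj z \<in> {z. Im z > 0} - U"
          using z by (auto intro: image_eqI [of _ cnj "cnj z"])
        then show ?thesis
          by (metis UnI2 complex_cnj_cnj image_eqI)
      qed (use z in auto)
    qed
    show "countable (({z. Im z > 0} - U) \<union> cnj ` ({z. Im z > 0} - U))"
      using U(3) by simp
  qed
  ultimately show ?thesis
    using U(1) \<open>open (cnj ` U)\<close> by (intro that [of "U \<union> cnj ` U"]) auto
qed

text \<open>The general existence theorem is applied to the higher derivatives of
  \<open>j_fun\<close> on the open set where holomorphy is known; the annihilated constants take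
  care of the countable rest.\<close>

theorem theorem5p17:
  "\<exists>D :: complex \<Rightarrow> complex. j_derivation D \<and> (\<exists>x. D x \<noteq> 0)"
proof -
  obtain \<Omega> where \<Omega>: "open \<Omega>" "countable ({z. Im z \<noteq> 0} - \<Omega>)" "j_fun holomorphic_on \<Omega>"
    by (rule j_fun_holomorphic_except_countable)
  \<comment> \<open>Killing the points of \<open>E\<close> together with the values of \<open>j\<close> and its derivatives there makes the
    equations hold at these points too, so it need not be shown that the discriminant has no zeros.\<close>
  define E where "E = {z. Im z \<noteq> 0} - \<Omega>"
  define K where "K = insert 0 (E \<union> (\<Union>r. (deriv ^^ r) j_fun ` E))"
  have "countable K"
    using \<Omega>(2) by (auto simp: K_def E_def)
  \<comment> \<open>\<open>from_nat_into\<close> enumerates exactly \<open>K\<close> only if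
    \<open>K\<close> is nonempty; hence the \<open>0\<close> in it, which every derivation
    annihilates.\<close>
  then have K: "range (from_nat_into K) = K"
    by (intro range_from_nat_into) (auto simp: K_def)
  interpret derivative_family "\<lambda>r. (deriv ^^ r) j_fun" \<Omega> "from_nat_into K"
  proof
    show "((deriv ^^ r) j_fun has_field_derivative (deriv ^^ Suc r) j_fun z) (at z)" if "z \<in> \<Omega>" for r z
      using holomorphic_derivI [OF holomorphic_higher_deriv [OF \<Omega>(3,1)] \<Omega>(1) that] by simp
  qed (fact \<Omega>(1))
  obtain D t where D: "derivation D" "D t \<noteq> 0" "\<And>i. D (from_nat_into K i) = 0"
    "\<And>r z. z \<in> \<Omega> \<Longrightarrow> D ((deriv ^^ r) j_fun z) = (deriv ^^ Suc r) j_fun z * D z"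
    using exists_nontrivial_derivation by blast
  have D0: "D x = 0" if "x \<in> K" for x
    using D(3) that K by (metis imageE)
  have step: "D ((deriv ^^ r) j_fun z) = (deriv ^^ Suc r) j_fun z * D z" if "Im z > 0 \<or> Im z < 0" for r z
  proof (cases "z \<in> \<Omega>")
    case False
    then have "z \<in> E"
      using that by (auto simp: E_def)
    then have "z \<in> K" "(deriv ^^ r) j_fun z \<in> K"
      unfolding K_def by blast+
    then have "D z = 0" "D ((deriv ^^ r) j_fun z) = 0"
      by (simp_all only: D0)
    then show ?thesis
      by simp
  qed (rule D(4))
  have "j_derivation D"
    unfolding j_derivation_def
    using D(1) step [of _ 0] step [of _ 1] step [of _ 2] by (simp add: numeral_eq_Suc)
  with D(2) show ?thesis
    by blast
qed

end
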